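(* Let $G$ be a finitely generated group which admits a convergence group action $G\curvearrowright M$ on a compact metrizable space $M$ with limit set satisfying $|L(G)|>2$. Then $$\ker\left(G \curvearrowright \mathrm{Cone}_{\omega}(G,d_n)\right) = \ker\left(G \curvearrowright L(G)\right) = K(G) = \mathrm{FC}(G) = \mathcal{A}(G)$$ for every non-principal ultrafilter $\omega$ on $\mathbb{N}$ and every unbounded non-decreasing sequence $(d_n)$ of positive reals.
   Context: Asymptotic cones. Let $G$ be a finitely generated group with finite generating set $S$ and word length $\|\cdot\|_S$, $\omega$ a non-principal ultrafilter on $\mathbb{N}$, and $(d_n)$ an unbounded non-decreasing sequence of positive reals. $\mathrm{Cone}_\omega(G,d_n)$ is the ultralimit of $(\Gamma(G,S), \frac{1}{d_n}d_S, e)$; its points are represented by sequences $\{x_n\}$ in $G$ with $\|x_n\|_S/d_n$ bounded (admissible sequences), where $\{x_n\}=\{y_n\}$ iff $\lim_\omega \|x_n^{-1}y_n\|_S/d_n=0$. $G$ acts isometrically by $g\cdot\{x_n\}=\{gx_n\}$. The kernel is the set of $g \in G$ with $\lim_\omega \|x_n^{-1}gx_n\|_S/d_n=0$ for all admissible $\{x_n\}$. Convergence groups. An action of $G$ by homeomorphisms on a compact metrizable space $M$ is a convergence (group) action if for every infinite sequence of distinct elements $g_n\in G$ there are a subsequence $g_{n_k}$ and points $x,y\in M$ (not necessarily distinct) such that for every open $U\ni y$ and every compact $K\subset M\setminus\{x\}$ there is $N>0$ with $g_{n_k}(K)\subset U$ for all $k>N$. The domain of discontinuity $\Omega(G)$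 is the set of points of $M$ where $G$ acts properly discontinuously (points having a neighbourhood $U$ with $\{g: gU\cap U\neq\emptyset\}$ finite), and the limit set is $L(G)=M\setminus\Omega(G)$, a $G$-invariant set. Subgroups. $K(G)$ is the unique maximal finite normal subgroup (the finite normal subgroup containing all finite normal subgroups; it exists for the groups considered here). $\mathrm{FC}(G)=\{g\in G: |\{x^{-1}gx: x\in G\}|<\infty\}$. $\mathcal{A}(G)$ is the amenable radical, i.e. the unique maximal amenable normal subgroup of $G$. *)

theory Defs
  imports "HOL-Analysis.Analysis" "HOL-Algebra.Group_Action" "HOL-Algebra.Generated_Groups"
begin

section \<open>Kernels of actions\<close>

definition action_kernel :: "('a, 'm) monoid_scheme \<Rightarrow> 'p set \<Rightarrow> ('a \<Rightarrow> 'p \<Rightarrow> 'p) \<Rightarrow> 'a set"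
  where "action_kernel G P \<phi> = {g \<in> carrier G. \<forall>p\<in>P. \<phi> g p = p}"


section \<open>Asymptotic cones\<close>

text \<open>Words are over \<open>S\<close> and the inverses of its elements, so \<open>S\<close> need not be symmetric.
  The value is meaningful only on the subgroup generated by \<open>S\<close>.\<close>

definition word_length :: "('a, 'm) monoid_scheme \<Rightarrow> 'a set \<Rightarrow> 'a \<Rightarrow> nat"
  where "word_length G S g =
    (LEAST n. \<exists>ws. set ws \<subseteq> S \<union> m_inv G ` S \<and> length ws = n \<and> foldr (mult G) ws \<one>\<^bsub>G\<^esub> = g)"

definition word_dist :: "('a, 'm) monoid_scheme \<Rightarrow> 'a set \<Rightarrow> 'a \<Rightarrow> 'a \<Rightarrow> nat"
  where "word_dist G S x y = word_length G S (inv\<^bsub>G\<^esub> x \<otimes>\<^bsub>G\<^esub> y)"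

definition nonprincipal_ultrafilter :: "'i filter \<Rightarrow> bool"
  where "nonprincipal_ultrafilter \<omega> \<longleftrightarrow>
    \<omega> \<noteq> bot \<and>
    (\<forall>P. eventually P \<omega> \<or> eventually (\<lambda>i. \<not> P i) \<omega>) \<and>
    (\<forall>i. \<omega> \<noteq> principal {i})"

definition admissible :: "('a, 'm) monoid_scheme \<Rightarrow> 'a set \<Rightarrow> (nat \<Rightarrow> real) \<Rightarrow> (nat \<Rightarrow> 'a) set"
  where "admissible G S d =
    {x. (\<forall>n. x n \<in> carrier G) \<and> (\<exists>B. \<forall>n. real (word_length G S (x n)) / d n \<le> B)}"

definition cone_rel ::
  "('a, 'm) monoid_scheme \<Rightarrow> 'a set \<Rightarrow> nat filter \<Rightarrow> (nat \<Rightarrow> real) \<Rightarrow> ((nat \<Rightarrow> 'a) \<times> (nat \<Rightarrow> 'a)) set"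
  where "cone_rel G S \<omega> d =
    {(x, y). x \<in> admissible G S d \<and> y \<in> admissible G S d \<and>
       ((\<lambda>n. real (word_dist G S (x n) (y n)) / d n) \<longlongrightarrow> 0) \<omega>}"

text \<open>The set of points of the ultralimit of the rescaled Cayley graphs. Sequences of vertices suffice,
  since every point of the Cayley graph is within distance 1/2 of a vertex and the scaling factors
  tend to infinity.\<close>

definition asymptotic_cone ::
  "('a, 'm) monoid_scheme \<Rightarrow> 'a set \<Rightarrow> nat filter \<Rightarrow> (nat \<Rightarrow> real) \<Rightarrow> (nat \<Rightarrow> 'a) set set"
  where "asymptotic_cone G S \<omega> d = admissible G S d // cone_rel G S \<omega> d"

definition cone_action :: "('a, 'm) monoid_scheme \<Rightarrow> 'a \<Rightarrow> (nat \<Rightarrow> 'a) set \<Rightarrow> (nat \<Rightarrow> 'a) set"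
  where "cone_action G g C = (\<lambda>x n. g \<otimes>\<^bsub>G\<^esub> x n) ` C"


section \<open>Convergence actions\<close>

locale convergence_action = group_action G "topspace X" \<phi>
  for G :: "('a, 'm) monoid_scheme" (structure) and X :: "'p topology" and \<phi> :: "'a \<Rightarrow> 'p \<Rightarrow> 'p" +
  assumes homeomorphic: "g \<in> carrier G \<Longrightarrow> homeomorphic_map X X (\<phi> g)"
    and convergence:
      "\<And>g :: nat \<Rightarrow> 'a. \<lbrakk>inj g; range g \<subseteq> carrier G\<rbrakk> \<Longrightarrow>
        \<exists>r x y. strict_mono (r :: nat \<Rightarrow> nat) \<and> x \<in> topspace X \<and> y \<in> topspace X \<and>
          (\<forall>U K. openin X U \<and> y \<in> U \<and> compactin X K \<and> K \<subseteq> topspace X - {x} \<longrightarrow>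
             (\<exists>N>0. \<forall>k>N. \<phi> (g (r k)) ` K \<subseteq> U))"

definition domain_of_discontinuity ::
  "('a, 'm) monoid_scheme \<Rightarrow> 'p topology \<Rightarrow> ('a \<Rightarrow> 'p \<Rightarrow> 'p) \<Rightarrow> 'p set"
  where "domain_of_discontinuity G X \<phi> =
    {p \<in> topspace X. \<exists>U. openin X U \<and> p \<in> U \<and> finite {g \<in> carrier G. \<phi> g ` U \<inter> U \<noteq> {}}}"

definition limit_set ::
  "('a, 'm) monoid_scheme \<Rightarrow> 'p topology \<Rightarrow> ('a \<Rightarrow> 'p \<Rightarrow> 'p) \<Rightarrow> 'p set"
  where "limit_set G X \<phi> = topspace X - domain_of_discontinuity G X \<phi>"


section \<open>The finite radical, the FC-centre and the amenable radical\<close>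

definition is_finite_radical :: "('a, 'm) monoid_scheme \<Rightarrow> 'a set \<Rightarrow> bool"
  where "is_finite_radical G K \<longleftrightarrow>
    K \<lhd> G \<and> finite K \<and> (\<forall>N. N \<lhd> G \<and> finite N \<longrightarrow> N \<subseteq> K)"

text \<open>\<open>finite_radical\<close> and \<open>amenable_radical\<close> are unspecified if no such subgroup exists.\<close>

definition finite_radical :: "('a, 'm) monoid_scheme \<Rightarrow> 'a set"
  where "finite_radical G = (THE K. is_finite_radical G K)"

definition FC_center :: "('a, 'm) monoid_scheme \<Rightarrow> 'a set"
  where "FC_center G =
    {g \<in> carrier G. finite {inv\<^bsub>G\<^esub> x \<otimes>\<^bsub>G\<^esub> g \<otimes>\<^bsub>G\<^esub> x | x. x \<in> carrier G}}"

text \<open>Amenability of a discrete group in the sense of von Neumann: a left-invariant finitely additive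
  probability measure defined on all subsets.\<close>

definition amenable :: "('a, 'm) monoid_scheme \<Rightarrow> bool"
  where "amenable G \<longleftrightarrow>
    (\<exists>\<mu> :: 'a set \<Rightarrow> real.
      (\<forall>A. A \<subseteq> carrier G \<longrightarrow> 0 \<le> \<mu> A) \<and>
      \<mu> (carrier G) = 1 \<and>
      (\<forall>A B. A \<subseteq> carrier G \<and> B \<subseteq> carrier G \<and> A \<inter> B = {} \<longrightarrow> \<mu> (A \<union> B) = \<mu> A + \<mu> B) \<and>
      (\<forall>g\<in>carrier G. \<forall>A. A \<subseteq> carrier G \<longrightarrow> \<mu> (g <#\<^bsub>G\<^esub> A) = \<mu> A))"

definition is_amenable_radical :: "('a, 'm) monoid_scheme \<Rightarrow> 'a set \<Rightarrow> bool"
  where "is_amenable_radical G A \<longleftrightarrow>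
    A \<lhd> G \<and> amenable (G\<lparr>carrier := A\<rparr>) \<and>
    (\<forall>N. N \<lhd> G \<and> amenable (G\<lparr>carrier := N\<rparr>) \<longrightarrow> N \<subseteq> A)"

definition amenable_radical :: "('a, 'm) monoid_scheme \<Rightarrow> 'a set"
  where "amenable_radical G = (THE A. is_amenable_radical G A)"


section \<open>The kernel of the action on the cone in terms of sequences\<close>

context group begin

lemma foldr_mult_closed:
  "set ws \<subseteq> carrier G \<Longrightarrow> foldr (mult G) ws \<one> \<in> carrier G"
  by (induction ws) auto

lemma foldr_mult_append:
  assumes "set us \<subseteq> carrier G" "set vs \<subseteq> carrier G"
  shows "foldr (mult G) (us @ vs) \<one> = foldr (mult G) us \<one> \<otimes> foldr (mult G) vs \<one>"
  using assms by (induction us) (auto simp: foldr_mult_closed m_assoc simp del: foldr_append)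

lemma foldr_mult_rev_inv:
  assumes "set us \<subseteq> carrier G"
  shows "foldr (mult G) (rev (map (m_inv G) us)) \<one> = inv (foldr (mult G) us \<one>)"
  using assms
proof (induction us)
  case (Cons a us)
  then have "set (rev (map (m_inv G) us)) \<subseteq> carrier G" "set [inv a] \<subseteq> carrier G" by auto
  from foldr_mult_append[OF this] Cons show ?case
    by (simp add: foldr_mult_closed inv_mult_group del: foldr_append)
qed simp

lemma word_exists:
  assumes S: "S \<subseteq> carrier G" and g: "g \<in> generate G S"
  shows "\<exists>ws. set ws \<subseteq> S \<union> m_inv G ` S \<and> foldr (mult G) ws \<one> = g"
  using g
proof induction
  case one
  show ?case by (rule exI[of _ "[]"]) simp
next
  case (incl h)
  then show ?case using S by (intro exI[of _ "[h]"]) auto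
next
  case (inv h)
  then show ?case using S by (intro exI[of _ "[inv h]"]) auto
next
  case (eng h1 h2)
  then obtain us vs where us: "set us \<subseteq> S \<union> m_inv G ` S" "foldr (mult G) us \<one> = h1"
    and vs: "set vs \<subseteq> S \<union> m_inv G ` S" "foldr (mult G) vs \<one> = h2" by blast
  have "S \<union> m_inv G ` S \<subseteq> carrier G" using S by auto
  with us vs have "foldr (mult G) (us @ vs) \<one> = h1 \<otimes> h2"
    using foldr_mult_append[of us vs] by (metis subset_trans)
  with us vs show ?case by (metis set_append Un_least)
qed

lemma word_length_witness:
  assumes "S \<subseteq> carrier G" "g \<in> generate G S"
  obtains ws where "set ws \<subseteq> S \<union> m_inv G ` S" "foldr (mult G) ws \<one> = g"
    "length ws = word_length G S g"
proof -
  have "\<exists>n ws. set ws \<subseteq> S \<union> m_inv G ` S \<and> length ws = n \<and> foldr (mult G) ws \<one> = g"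
    using word_exists[OF assms] by blast
  from LeastI_ex[OF this] show thesis
    using that unfolding word_length_def by blast
qed

lemma word_length_le:
  assumes "set ws \<subseteq> S \<union> m_inv G ` S" "foldr (mult G) ws \<one> = g"
  shows "word_length G S g \<le> length ws"
  unfolding word_length_def by (rule Least_le) (use assms in blast)

lemma word_length_one: "word_length G S \<one> = 0"
  using word_length_le[of "[]" S \<one>] by simp

lemma word_length_mult_le:
  assumes S: "S \<subseteq> carrier G" and g: "g \<in> generate G S" and h: "h \<in> generate G S"
  shows "word_length G S (g \<otimes> h) \<le> word_length G S g + word_length G S h"
proof -
  obtain us where us: "set us \<subseteq> S \<union> m_inv G ` S" "foldr (mult G) us \<one> = g"
    "length us = word_length G S g" using word_length_witness[OF S g] .
  obtain vs where vs: "set vs \<subseteq> S \<union> m_inv G ` S" "foldr (mult G) vs \<one> = h"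
    "length vs = word_length G S h" using word_length_witness[OF S h] .
  have "S \<union> m_inv G ` S \<subseteq> carrier G" using S by auto
  with us vs have "foldr (mult G) (us @ vs) \<one> = g \<otimes> h"
    using foldr_mult_append[of us vs] by (metis subset_trans)
  with us vs show ?thesis using word_length_le[of "us @ vs" S "g \<otimes> h"] by simp
qed

lemma word_length_inv_le:
  assumes S: "S \<subseteq> carrier G" and g: "g \<in> generate G S"
  shows "word_length G S (inv g) \<le> word_length G S g"
proof -
  obtain us where us: "set us \<subseteq> S \<union> m_inv G ` S" "foldr (mult G) us \<one> = g"
    "length us = word_length G S g" using word_length_witness[OF S g] .
  have sub: "S \<union> m_inv G ` S \<subseteq> carrier G" using S by auto
  have "set (rev (map (m_inv G) us)) \<subseteq> S \<union> m_inv G ` S"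
    using us(1) S by (auto simp: subset_iff)
  moreover have "foldr (mult G) (rev (map (m_inv G) us)) \<one> = inv g"
    using foldr_mult_rev_inv[of us] us sub by (metis subset_trans)
  ultimately show ?thesis using word_length_le[of "rev (map (m_inv G) us)" S "inv g"] us(3) by simp
qed

context
  fixes S :: "'a set" and \<omega> :: "nat filter" and d :: "nat \<Rightarrow> real"
  assumes S: "S \<subseteq> carrier G" and gen: "generate G S = carrier G" and pos: "\<And>n. d n > 0"
    and inc: "incseq d"
begin

lemma equiv_cone_rel: "equiv (admissible G S d) (cone_rel G S \<omega> d)"
proof (rule equivI)
  show "cone_rel G S \<omega> d \<subseteq> admissible G S d \<times> admissible G S d"
    by (auto simp: cone_rel_def)
  show "refl_on (admissible G S d) (cone_rel G S \<omega> d)"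
    by (auto simp: refl_on_def cone_rel_def admissible_def word_dist_def word_length_one)
  show "sym (cone_rel G S \<omega> d)"
  proof (rule symI)
    fix x y assume "(x, y) \<in> cone_rel G S \<omega> d"
    then have x: "x \<in> admissible G S d" and y: "y \<in> admissible G S d"
      and lim: "((\<lambda>n. real (word_dist G S (x n) (y n)) / d n) \<longlongrightarrow> 0) \<omega>"
      by (auto simp: cone_rel_def)
    have "word_dist G S (y n) (x n) \<le> word_dist G S (x n) (y n)" for n
    proof -
      have "x n \<in> carrier G" "y n \<in> carrier G" using x y by (auto simp: admissible_def)
      then show ?thesis using word_length_inv_le[OF S, of "inv (x n) \<otimes> y n"] gen
        by (simp add: word_dist_def inv_mult_group)
    qed
    then have "((\<lambda>n. real (word_dist G S (y n) (x n)) / d n) \<longlongrightarrow> 0) \<omega>"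
      using pos by (intro tendsto_sandwich[OF _ _ tendsto_const lim] always_eventually)
        (auto simp: less_imp_le intro!: divide_right_mono)
    then show "(y, x) \<in> cone_rel G S \<omega> d" using x y by (simp add: cone_rel_def)
  qed
  show "trans (cone_rel G S \<omega> d)"
  proof (rule transI)
    fix x y z assume "(x, y) \<in> cone_rel G S \<omega> d" "(y, z) \<in> cone_rel G S \<omega> d"
    then have x: "x \<in> admissible G S d" and y: "y \<in> admissible G S d" and z: "z \<in> admissible G S d"
      and 1: "((\<lambda>n. real (word_dist G S (x n) (y n)) / d n) \<longlongrightarrow> 0) \<omega>"
      and 2: "((\<lambda>n. real (word_dist G S (y n) (z n)) / d n) \<longlongrightarrow> 0) \<omega>"
      by (auto simp: cone_rel_def)
    have lim: "((\<lambda>n. real (word_dist G S (x n) (y n)) / d n + real (word_dist G S (y n) (z n)) / d n)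
        \<longlongrightarrow> 0) \<omega>"
      using tendsto_add[OF 1 2] by simp
    have le: "real (word_dist G S (x n) (z n)) \<le>
        real (word_dist G S (x n) (y n)) + real (word_dist G S (y n) (z n))" for n
    proof -
      have c: "x n \<in> carrier G" "y n \<in> carrier G" "z n \<in> carrier G"
        using x y z by (auto simp: admissible_def)
      have "y n \<otimes> (inv (y n) \<otimes> z n) = z n" using c by (simp add: m_assoc[symmetric])
      then have "inv (x n) \<otimes> z n = (inv (x n) \<otimes> y n) \<otimes> (inv (y n) \<otimes> z n)"
        using c by (simp add: m_assoc)
      then have "word_dist G S (x n) (z n) \<le> word_dist G S (x n) (y n) + word_dist G S (y n) (z n)"
        using word_length_mult_le[OF S, of "inv (x n) \<otimes> y n" "inv (y n) \<otimes> z n"] c gen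
        by (simp add: word_dist_def)
      then show ?thesis by linarith
    qed
    have "((\<lambda>n. real (word_dist G S (x n) (z n)) / d n) \<longlongrightarrow> 0) \<omega>"
      using pos le by (intro tendsto_sandwich[OF _ _ tendsto_const lim] always_eventually)
        (auto simp: less_imp_le add_divide_distrib[symmetric] intro!: divide_right_mono)
    then show "(x, z) \<in> cone_rel G S \<omega> d" using x z by (simp add: cone_rel_def)
  qed
qed

lemma admissible_translate:
  assumes g: "g \<in> carrier G" and x: "x \<in> admissible G S d"
  shows "(\<lambda>n. g \<otimes> x n) \<in> admissible G S d"
proof -
  obtain B where B: "\<And>n. real (word_length G S (x n)) / d n \<le> B"
    and xc: "\<And>n. x n \<in> carrier G" using x by (auto simp: admissible_def)
  have "real (word_length G S (g \<otimes> x n)) / d n \<le> real (word_length G S g) / d 0 + B" for n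
  proof -
    have "real (word_length G S (g \<otimes> x n)) \<le> real (word_length G S g) + real (word_length G S (x n))"
      using word_length_mult_le[OF S, of g "x n"] gen g xc by (simp flip: of_nat_add)
    then have "real (word_length G S (g \<otimes> x n)) / d n \<le>
        (real (word_length G S g) + real (word_length G S (x n))) / d n"
      using pos[of n] by (intro divide_right_mono) auto
    also have "\<dots> = real (word_length G S g) / d n + real (word_length G S (x n)) / d n"
      by (rule add_divide_distrib)
    also have "\<dots> \<le> real (word_length G S g) / d 0 + B"
      using incseqD[OF inc, of 0 n] pos[of 0] pos[of n] B[of n]
      by (intro add_mono divide_left_mono) auto
    finally show ?thesis .
  qed
  then show ?thesis using g xc by (auto simp: admissible_def)
qed

lemma cone_rel_translate:
  assumes g: "g \<in> carrier G" and xy: "(x, y) \<in> cone_rel G S \<omega> d"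
  shows "(\<lambda>n. g \<otimes> x n, \<lambda>n. g \<otimes> y n) \<in> cone_rel G S \<omega> d"
proof -
  have x: "x \<in> admissible G S d" and y: "y \<in> admissible G S d" using xy by (auto simp: cone_rel_def)
  have "word_dist G S (g \<otimes> x n) (g \<otimes> y n) = word_dist G S (x n) (y n)" for n
  proof -
    have c: "x n \<in> carrier G" "y n \<in> carrier G" using x y by (auto simp: admissible_def)
    have "inv g \<otimes> (g \<otimes> y n) = y n" using c g by (simp add: m_assoc[symmetric])
    then show ?thesis using c g by (simp add: word_dist_def inv_mult_group m_assoc)
  qed
  then show ?thesis using xy x y g by (simp add: cone_rel_def admissible_translate)
qed

lemma cone_action_class:
  assumes g: "g \<in> carrier G" and x: "x \<in> admissible G S d"
  shows "cone_action G g (cone_rel G S \<omega> d `` {x}) = cone_rel G S \<omega> d `` {\<lambda>n. g \<otimes> x n}"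
proof (intro equalityI subsetI)
  fix y assume "y \<in> cone_action G g (cone_rel G S \<omega> d `` {x})"
  then show "y \<in> cone_rel G S \<omega> d `` {\<lambda>n. g \<otimes> x n}"
    using cone_rel_translate[OF g] by (auto simp: cone_action_def)
next
  fix y assume y: "y \<in> cone_rel G S \<omega> d `` {\<lambda>n. g \<otimes> x n}"
  then have yc: "y n \<in> carrier G" for n by (auto simp: cone_rel_def admissible_def)
  have xc: "x n \<in> carrier G" for n using x by (auto simp: admissible_def)
  have "(\<lambda>n. inv g \<otimes> (g \<otimes> x n), \<lambda>n. inv g \<otimes> y n) \<in> cone_rel G S \<omega> d"
    using y g cone_rel_translate[of "inv g"] by auto
  moreover have "(\<lambda>n. inv g \<otimes> (g \<otimes> x n)) = x" using g xc by (auto simp: m_assoc[symmetric])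
  moreover have "y = (\<lambda>n. g \<otimes> (inv g \<otimes> y n))" using g yc by (auto simp: m_assoc[symmetric])
  ultimately show "y \<in> cone_action G g (cone_rel G S \<omega> d `` {x})"
    unfolding cone_action_def by (intro image_eqI[of _ _ "\<lambda>n. inv g \<otimes> y n"]) auto
qed

lemma cone_kernel_eq:
  "action_kernel G (asymptotic_cone G S \<omega> d) (cone_action G) =
    {g \<in> carrier G. \<forall>x\<in>admissible G S d.
       ((\<lambda>n. real (word_length G S (inv (x n) \<otimes> g \<otimes> x n)) / d n) \<longlongrightarrow> 0) \<omega>}"
proof -
  have "(cone_action G g (cone_rel G S \<omega> d `` {x}) = cone_rel G S \<omega> d `` {x}) \<longleftrightarrow>
      ((\<lambda>n. real (word_length G S (inv (x n) \<otimes> g \<otimes> x n)) / d n) \<longlongrightarrow> 0) \<omega>"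
    if g: "g \<in> carrier G" and x: "x \<in> admissible G S d" for g x
  proof -
    have gx: "(\<lambda>n. g \<otimes> x n) \<in> admissible G S d" by (rule admissible_translate[OF g x])
    have "x n \<in> carrier G" for n using x by (auto simp: admissible_def)
    then have dist: "word_dist G S (x n) (g \<otimes> x n) = word_length G S (inv (x n) \<otimes> g \<otimes> x n)" for n
      using g by (simp add: word_dist_def m_assoc)
    have "(cone_action G g (cone_rel G S \<omega> d `` {x}) = cone_rel G S \<omega> d `` {x}) \<longleftrightarrow>
        (x, \<lambda>n. g \<otimes> x n) \<in> cone_rel G S \<omega> d"
      unfolding cone_action_class[OF g x] using eq_equiv_class_iff[OF equiv_cone_rel x gx] by auto
    then show ?thesis using x gx by (simp add: cone_rel_def dist)
  qed
  then show ?thesis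
    unfolding action_kernel_def asymptotic_cone_def quotient_def by auto
qed

end

end

end

theory Submission
  imports Defs
begin

text \<open>Let K be the kernel of the action on the limit set. An infinite K would contain a sequence
  collapsing M minus a point to a point while fixing at least two limit points, so K is finite; being
  normal, it lies in the FC-centre, which lies in the kernel on the cone because conjugates of its
  elements have bounded length. It remains to show that the elements of the kernel on the cone and of
  the amenable normal subgroups fix every limit point.

  If g moves a limit point p, some h collapses the complement of a small set B into a neighbourhood A
  of p with gA disjoint from A. Fix a triple T of points and read off, for an element k, whether the
  majority of kT lies in A or in B. Counting the translates of the pair (A, B) under powers of h that
  separate two elements is a coarsely Lipschitz function for the word metric, and it separates
  \<open>h\<^sup>m\<close> from \<open>g h\<^sup>m\<close> by about m. Hence the conjugates of g by \<open>h\<^sup>m\<close> have length linear in m,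
  and g acts non-trivially on the cone.

  If g lies in a normal subgroup N, then N fixes no point, since otherwise G would have a global
  fixed point. Conjugating elements of N by collapsing sequences gives, around any limit point q and
  for every neighbourhood Q of q, an element of N mapping the complement of Q into Q. An invariant
  mean on N would give orbit measure at least 1/2 to each of three disjoint such Q.\<close>

section \<open>Collapsing sequences\<close>

text \<open>The convergence property speaks of distinct elements only. Each value is chosen outside
  the finitely many earlier ones, which cannot exhaust an infinite set.\<close>

lemma injective_choice:
  fixes R :: "nat \<Rightarrow> 'b set"
  assumes "\<And>n. infinite (R n)"
  shows "\<exists>f. inj f \<and> (\<forall>n. f n \<in> R n)"
proof -
  have "\<exists>f. \<forall>n. f n \<in> R n - f ` {..<n}"
  proof (rule dependent_wellorder_choice)
    fix f :: "nat \<Rightarrow> 'b" and n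
    show "\<exists>g. g \<in> R n - f ` {..<n}"
      using Diff_infinite_finite[OF _ assms, of "f ` {..<n}"] infinite_imp_nonempty by blast
  next
    fix f g :: "nat \<Rightarrow> 'b" and n :: nat and r
    assume "\<And>z. z < n \<Longrightarrow> f z = g z"
    then have "f ` {..<n} = g ` {..<n}" by (intro image_cong) auto
    then show "(r \<in> R n - f ` {..<n}) = (r \<in> R n - g ` {..<n})" by simp
  qed
  then obtain f where f: "\<forall>n. f n \<in> R n - f ` {..<n}" ..
  have "f m \<noteq> f n" if "m < n" for m n
    using f that by (metis DiffD2 imageI lessThan_iff)
  then have "inj f" by (rule linorder_injI)
  with f show ?thesis by blast
qed

lemma (in group) inj_pow:
  assumes h: "h \<in> carrier G" and "\<And>e::nat. e > 0 \<Longrightarrow> h [^] e \<noteq> \<one>"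
  shows "inj (\<lambda>n::nat. h [^] n)"
proof (rule linorder_injI)
  fix i j :: nat assume "i < j"
  then have "h [^] j = h [^] i \<otimes> h [^] (j - i)" using h by (simp add: nat_pow_mult)
  then show "h [^] i \<noteq> h [^] j" using assms(2)[of "j - i"] \<open>i < j\<close> h by simp
qed

section \<open>Homeomorphisms of a compact metrizable space, separation and collapsing\<close>

locale compact_convergence_action = convergence_action G X \<phi>
  for G :: "('a, 'm) monoid_scheme" (structure) and X :: "'p topology" and \<phi> :: "'a \<Rightarrow> 'p \<Rightarrow> 'p" +
  assumes compact: "compact_space X" and metrizable: "metrizable_space X"
begin

sublocale group G
  using group_hom by (rule group_hom.axioms(1))

lemma act_closed [simp]: "g \<in> carrier G \<Longrightarrow> z \<in> topspace X \<Longrightarrow> \<phi> g z \<in> topspace X"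
  using element_image by blast

lemma act_mult: "g \<in> carrier G \<Longrightarrow> h \<in> carrier G \<Longrightarrow> z \<in> topspace X \<Longrightarrow> \<phi> (g \<otimes> h) z = \<phi> g (\<phi> h z)"
  by (rule composition_rule)

lemma act_one [simp]: "z \<in> topspace X \<Longrightarrow> \<phi> \<one> z = z"
  by (metis id_eq_one restrict_apply')

lemma act_inv_act [simp]: "g \<in> carrier G \<Longrightarrow> z \<in> topspace X \<Longrightarrow> \<phi> (inv g) (\<phi> g z) = z"
  by (metis act_mult act_one inv_closed l_inv)

lemma act_act_inv [simp]: "g \<in> carrier G \<Longrightarrow> z \<in> topspace X \<Longrightarrow> \<phi> g (\<phi> (inv g) z) = z"
  by (metis act_mult act_one inv_closed r_inv)

lemma act_eq_iff [simp]:
  "g \<in> carrier G \<Longrightarrow> y \<in> topspace X \<Longrightarrow> z \<in> topspace X \<Longrightarrow> \<phi> g y = \<phi> g z \<longleftrightarrow> y = z"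
  by (metis act_inv_act)

lemma openin_act: "g \<in> carrier G \<Longrightarrow> openin X U \<Longrightarrow> openin X (\<phi> g ` U)"
  by (simp add: homeomorphic_map_openness[OF homeomorphic] openin_subset)

lemma closedin_act: "g \<in> carrier G \<Longrightarrow> closedin X C \<Longrightarrow> closedin X (\<phi> g ` C)"
  by (simp add: homeomorphic_map_closedness[OF homeomorphic] closedin_subset)

lemma act_in_image_iff:
  assumes "g \<in> carrier G" "A \<subseteq> topspace X" "z \<in> topspace X"
  shows "z \<in> \<phi> g ` A \<longleftrightarrow> \<phi> (inv g) z \<in> A"
proof
  assume "z \<in> \<phi> g ` A"
  then show "\<phi> (inv g) z \<in> A" using assms by (auto simp: subset_iff)
next
  assume "\<phi> (inv g) z \<in> A"
  then show "z \<in> \<phi> g ` A" using assms by (intro image_eqI[of _ _ "\<phi> (inv g) z"]) auto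
qed

lemma Hausdorff: "Hausdorff_space X"
  by (rule metrizable_imp_Hausdorff_space[OF metrizable])

lemma separation:
  assumes "a \<in> topspace X" "b \<in> topspace X" "a \<noteq> b"
  obtains U V where "openin X U" "openin X V" "a \<in> U" "b \<in> V" "U \<inter> V = {}"
  using assms Hausdorff by (metis Hausdorff_space_def disjnt_def)

lemma closed_neighbourhood:
  assumes "openin X W" "a \<in> W"
  obtains U C where "openin X U" "closedin X C" "a \<in> U" "U \<subseteq> C" "C \<subseteq> W"
  using metrizable_imp_regular_space[OF metrizable] assms
  unfolding neighbourhood_base_of_closedin[symmetric] neighbourhood_base_of by metis

lemma closed_separation:
  assumes "a \<in> topspace X" "b \<in> topspace X" "a \<noteq> b"
  obtains U V C D where "openin X U" "openin X V" "closedin X C" "closedin X D"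
    "a \<in> U" "U \<subseteq> C" "b \<in> V" "V \<subseteq> D" "C \<inter> D = {}"
proof -
  obtain U V where UV: "openin X U" "openin X V" "a \<in> U" "b \<in> V" "U \<inter> V = {}"
    using separation[OF assms] .
  obtain U' C where "openin X U'" "closedin X C" "a \<in> U'" "U' \<subseteq> C" "C \<subseteq> U"
    using closed_neighbourhood[OF UV(1,3)] .
  moreover obtain V' D where "openin X V'" "closedin X D" "b \<in> V'" "V' \<subseteq> D" "D \<subseteq> V"
    using closed_neighbourhood[OF UV(2,4)] .
  ultimately show thesis using that[of U' V' C D] UV by blast
qed

lemma displaced_neighbourhood:
  assumes g: "g \<in> carrier G" and p: "p \<in> topspace X" and "\<phi> g p \<noteq> p"
  obtains W where "openin X W" "p \<in> W" "\<phi> g ` W \<inter> W = {}"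
proof -
  obtain U V where UV: "openin X U" "openin X V" "p \<in> U" "\<phi> g p \<in> V" "U \<inter> V = {}"
    using separation[of p "\<phi> g p"] assms by auto
  let ?W = "U \<inter> \<phi> (inv g) ` V"
  have "openin X ?W" using UV g by (simp add: openin_Int openin_act)
  moreover have "p \<in> ?W"
    using UV p g by (auto simp: image_iff intro!: bexI[of _ "\<phi> g p"])
  moreover have "\<phi> g ` ?W \<inter> ?W = {}"
  proof -
    have "\<phi> g z \<in> V" if "z \<in> ?W" for z
      using that UV(2) g openin_subset by (fastforce simp: subset_iff)
    then show ?thesis using UV(5) by blast
  qed
  ultimately show thesis using that by blast
qed

text \<open>Here \<open>x\<close> is the repelling and \<open>y\<close> the attracting point, the
  subsequence having been taken already. Closed sets replace compact ones because the space is
  compact.\<close>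

definition collapses :: "(nat \<Rightarrow> 'a) \<Rightarrow> 'p \<Rightarrow> 'p \<Rightarrow> bool"
  where "collapses f x y \<longleftrightarrow> inj f \<and> range f \<subseteq> carrier G \<and> x \<in> topspace X \<and> y \<in> topspace X \<and>
    (\<forall>U K. openin X U \<and> y \<in> U \<and> closedin X K \<and> x \<notin> K \<longrightarrow> (\<forall>\<^sub>F n in sequentially. \<phi> (f n) ` K \<subseteq> U))"

lemma collapsesD:
  assumes "collapses f x y"
  shows "inj f" "f n \<in> carrier G" "x \<in> topspace X" "y \<in> topspace X"
    "openin X U \<Longrightarrow> y \<in> U \<Longrightarrow> closedin X K \<Longrightarrow> x \<notin> K \<Longrightarrow> \<forall>\<^sub>F n in sequentially. \<phi> (f n) ` K \<subseteq> U"
  using assms unfolding collapses_def by auto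

lemma collapses_set:
  assumes f: "collapses f x y" and U: "openin X U" "y \<in> U" and V: "openin X V" "x \<in> V"
  obtains n where "\<phi> (f n) ` (topspace X - V) \<subseteq> U"
  using collapsesD(5)[OF f U, of "topspace X - V"] V eventually_happens by force

lemma collapsing_subsequence:
  fixes g :: "nat \<Rightarrow> 'a"
  assumes "inj g" "range g \<subseteq> carrier G"
  obtains r x y where "strict_mono r" "collapses (g \<circ> r) x y"
proof -
  obtain r x y where r: "strict_mono (r :: nat \<Rightarrow> nat)" and xy: "x \<in> topspace X" "y \<in> topspace X"
    and *: "\<forall>U K. openin X U \<and> y \<in> U \<and> compactin X K \<and> K \<subseteq> topspace X - {x} \<longrightarrow>
      (\<exists>N>0. \<forall>k>N. \<phi> (g (r k)) ` K \<subseteq> U)"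
    using convergence[OF assms] by (elim exE conjE) (rule that)
  have "collapses (g \<circ> r) x y"
    unfolding collapses_def
  proof (intro conjI allI impI)
    show "inj (g \<circ> r)" using r assms(1) by (simp add: inj_compose strict_mono_imp_inj_on)
    show "range (g \<circ> r) \<subseteq> carrier G" using assms(2) by auto
    fix U K assume UK: "openin X U \<and> y \<in> U \<and> closedin X K \<and> x \<notin> K"
    then have "compactin X K" "K \<subseteq> topspace X - {x}"
      using closedin_compact_space[OF compact] closedin_subset by blast+
    with * UK obtain N where "\<forall>k>N. \<phi> (g (r k)) ` K \<subseteq> U" by blast
    then show "\<forall>\<^sub>F n in sequentially. \<phi> ((g \<circ> r) n) ` K \<subseteq> U"
      unfolding eventually_sequentially comp_def by (meson Suc_le_lessD)
  qed (use xy in auto)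
  with r that show thesis by blast
qed

lemma infinite_collapses:
  assumes "infinite F" "F \<subseteq> carrier G"
  obtains f x y where "collapses f x y" "range f \<subseteq> F"
proof -
  obtain g :: "nat \<Rightarrow> 'a" where "inj g" "range g \<subseteq> F" 
    using infinite_countable_subset[OF assms(1)] by auto
  then have "inj g" "range g \<subseteq> carrier G" using assms(2) by auto
  then obtain r x y where "collapses (g \<circ> r) x y" by (rule collapsing_subsequence)
  then show thesis by (rule that) (use \<open>range g \<subseteq> F\<close> in auto)
qed

lemma collapses_point_eventually:
  assumes "collapses f x y" "a \<in> topspace X" "a \<noteq> x" "openin X U" "y \<in> U"
  shows "\<forall>\<^sub>F n in sequentially. \<phi> (f n) a \<in> U"
  using collapsesD(5)[OF assms(1,4,5), of "{a}"] assms(2,3) Hausdorff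
  by (simp add: closedin_Hausdorff_sing_eq)

text \<open>Otherwise the complement of \<open>C\<close> is a neighbourhood of \<open>y\<close>
  which the images of \<open>a\<close> eventually enter. Attracting points are located in this way
  below.\<close>

lemma collapses_limit_in:
  assumes f: "collapses f x y" and a: "a \<in> topspace X" "a \<noteq> x" and C: "closedin X C"
    and "\<And>n. \<phi> (f n) a \<in> C"
  shows "y \<in> C"
proof (rule ccontr)
  assume "y \<notin> C"
  then have "\<forall>\<^sub>F n in sequentially. \<phi> (f n) a \<in> topspace X - C"
    using collapsesD(4)[OF f] C by (intro collapses_point_eventually[OF f a]) auto
  then show False using assms(5) eventually_happens by fastforce
qed

text \<open>By complementation, \<open>f n\<close> maps the complement of \<open>U\<close> off
  \<open>K\<close> exactly when its inverse maps \<open>K\<close> into \<open>U\<close>; so the two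
  points exchange roles.\<close>

lemma collapses_inv:
  assumes f: "collapses f x y"
  shows "collapses (\<lambda>n. inv (f n)) y x"
  unfolding collapses_def
proof (intro conjI allI impI)
  show "inj (\<lambda>n. inv (f n))"
  proof (rule injI)
    fix m n assume "inv (f m) = inv (f n)"
    then have "inv (inv (f m)) = inv (inv (f n))" by simp
    then have "f m = f n" using collapsesD(2)[OF f] by simp
    then show "m = n" using collapsesD(1)[OF f] by (simp add: inj_eq)
  qed
  show "range (\<lambda>n. inv (f n)) \<subseteq> carrier G" using collapsesD(2)[OF f] by auto
  fix U K assume UK: "openin X U \<and> x \<in> U \<and> closedin X K \<and> y \<notin> K"
  have "\<forall>\<^sub>F n in sequentially. \<phi> (f n) ` (topspace X - U) \<subseteq> topspace X - K"
    using UK collapsesD(4)[OF f] by (intro collapsesD(5)[OF f]) auto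
  then show "\<forall>\<^sub>F n in sequentially. \<phi> (inv (f n)) ` K \<subseteq> U"
  proof (rule eventually_mono)
    fix n assume n: "\<phi> (f n) ` (topspace X - U) \<subseteq> topspace X - K"
    show "\<phi> (inv (f n)) ` K \<subseteq> U"
    proof (rule image_subsetI)
      fix z assume z: "z \<in> K"
      then have "z \<in> topspace X" using UK closedin_subset by blast
      show "\<phi> (inv (f n)) z \<in> U"
      proof (rule ccontr)
        assume "\<phi> (inv (f n)) z \<notin> U"
        then have "\<phi> (inv (f n)) z \<in> topspace X - U"
          using \<open>z \<in> topspace X\<close> collapsesD(2)[OF f, of n] by simp
        then have "\<phi> (f n) (\<phi> (inv (f n)) z) \<in> topspace X - K" using n by blast
        then show False using z \<open>z \<in> topspace X\<close> collapsesD(2)[OF f, of n] by simp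
      qed
    qed
  qed
qed (use collapsesD(3,4)[OF f] in auto)

text \<open>Right translation moves only the repelling point; it serves to make the two points
  distinct.\<close>

lemma collapses_mult_right:
  assumes f: "collapses f x y" and g: "g \<in> carrier G"
  shows "collapses (\<lambda>n. f n \<otimes> g) (\<phi> (inv g) x) y"
  unfolding collapses_def
proof (intro conjI allI impI)
  note fc = collapsesD[OF f]
  show "inj (\<lambda>n. f n \<otimes> g)" using fc(1,2) g by (simp add: inj_def)
  show "range (\<lambda>n. f n \<otimes> g) \<subseteq> carrier G" using fc(2) g by auto
  fix U K assume UK: "openin X U \<and> y \<in> U \<and> closedin X K \<and> \<phi> (inv g) x \<notin> K"
  have K: "K \<subseteq> topspace X" using UK closedin_subset by blast
  have "x \<notin> \<phi> g ` K" using UK K g fc(3) by (simp add: act_in_image_iff)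
  then have "\<forall>\<^sub>F n in sequentially. \<phi> (f n) ` (\<phi> g ` K) \<subseteq> U"
    using UK g by (intro fc(5)) (auto intro: closedin_act)
  then show "\<forall>\<^sub>F n in sequentially. \<phi> (f n \<otimes> g) ` K \<subseteq> U"
    by (rule eventually_mono) (use K fc(2) g in \<open>auto simp: act_mult subset_iff\<close>)
qed (use collapsesD(3,4)[OF f] g in auto)

section \<open>Limit points as attracting and repelling points\<close>

abbreviation limits :: "'p set"
  where "limits \<equiv> limit_set G X \<phi>"

lemma limits_subset: "limits \<subseteq> topspace X"
  by (auto simp: limit_set_def)

lemma limits_infinite_return:
  assumes "p \<in> limits" "openin X U" "p \<in> U"
  shows "infinite {g \<in> carrier G. \<phi> g ` U \<inter> U \<noteq> {}}"
  using assms by (auto simp: limit_set_def domain_of_discontinuity_def)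

text \<open>Conjugation by \<open>g\<close> embeds the set of elements returning \<open>?V\<close>
  to itself into the corresponding set for \<open>U\<close>, so finiteness passes from
  \<open>\<phi> g p\<close> to \<open>p\<close>.\<close>

lemma limits_invariant:
  assumes g: "g \<in> carrier G" and p: "p \<in> limits"
  shows "\<phi> g p \<in> limits"
proof (rule ccontr)
  assume "\<phi> g p \<notin> limits"
  then obtain U where U: "openin X U" "\<phi> g p \<in> U" "finite {h \<in> carrier G. \<phi> h ` U \<inter> U \<noteq> {}}"
    using g p limits_subset by (auto simp: limit_set_def domain_of_discontinuity_def)
  have Us: "U \<subseteq> topspace X" using U(1) openin_subset by blast
  let ?V = "\<phi> (inv g) ` U"
  let ?R = "\<lambda>U. {h \<in> carrier G. \<phi> h ` U \<inter> U \<noteq> {}}"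
  have pV: "p \<in> ?V" using U(2) g p limits_subset by (auto intro!: image_eqI[of _ _ "\<phi> g p"])
  have "openin X ?V" using U(1) g by (intro openin_act) auto
  then have inf: "infinite (?R ?V)" using pV by (rule limits_infinite_return[OF p])
  have "(\<lambda>h. g \<otimes> h \<otimes> inv g) ` ?R ?V \<subseteq> ?R U"
  proof (rule image_subsetI)
    fix h assume "h \<in> ?R ?V"
    then obtain u v where h: "h \<in> carrier G" and uv: "u \<in> U" "v \<in> U"
      and e: "\<phi> h (\<phi> (inv g) u) = \<phi> (inv g) v" by auto
    have "\<phi> (g \<otimes> h \<otimes> inv g) u = \<phi> g (\<phi> h (\<phi> (inv g) u))"
      using h g uv(1) Us by (simp add: act_mult subsetD)
    also have "\<dots> = v" unfolding e using g uv(2) Us by (simp add: subsetD)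
    finally have "v \<in> \<phi> (g \<otimes> h \<otimes> inv g) ` U \<inter> U" using uv by blast
    then show "g \<otimes> h \<otimes> inv g \<in> ?R U" using h g by blast
  qed
  then have fin: "finite ((\<lambda>h. g \<otimes> h \<otimes> inv g) ` ?R ?V)" by (rule finite_subset[OF _ U(3)])
  have "inj_on (\<lambda>h. g \<otimes> h \<otimes> inv g) (carrier G)"
    using g by (intro inj_onI) simp
  then have "inj_on (\<lambda>h. g \<otimes> h \<otimes> inv g) (?R ?V)" by (rule inj_on_subset) blast
  with fin have "finite (?R ?V)" by (rule finite_imageD)
  with inf show False by contradiction
qed

text \<open>Balls of radius 1/(n+1) for a compatible metric. First countability allows one group
  element to be chosen per neighbourhood.\<close>

lemma neighbourhood_sequence:
  assumes "p \<in> topspace X"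
  shows "\<exists>U :: nat \<Rightarrow> 'p set. \<forall>n. openin X (U n) \<and> p \<in> U n \<and>
    (\<forall>V. openin X V \<longrightarrow> p \<in> V \<longrightarrow> (\<forall>\<^sub>F n in sequentially. U n \<subseteq> V))"
proof -
  obtain M d where "Metric_space M d" and X: "X = Metric_space.mtopology M d"
    using metrizable unfolding metrizable_space_def by blast
  interpret M: Metric_space M d by fact
  have pM: "p \<in> M" using assms unfolding X by simp
  show ?thesis
  proof (intro exI[of _ "\<lambda>n. M.mball p (1 / Suc n)"] allI conjI impI)
    show "openin X (M.mball p (1 / Suc n))" for n unfolding X by (rule M.openin_mball)
    show "p \<in> M.mball p (1 / Suc n)" for n using pM by simp
    fix V assume "openin X V" "p \<in> V"
    then obtain e where e: "e > 0" "M.mball p e \<subseteq> V" unfolding X M.openin_mtopology by blast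
    obtain N where N: "1 / Suc N < e" using e(1) nat_approx_posE by blast
    show "\<forall>\<^sub>F n in sequentially. M.mball p (1 / Suc n) \<subseteq> V"
      unfolding eventually_sequentially
    proof (intro exI[of _ N] allI impI)
      fix n assume "n \<ge> N"
      then have "1 / Suc n \<le> 1 / Suc N" by (simp add: frac_le)
      with N have "M.mball p (1 / Suc n) \<subseteq> M.mball p e" by (intro M.mball_subset_concentric) simp
      with e(2) show "M.mball p (1 / Suc n) \<subseteq> V" by (rule subset_trans[rotated])
    qed
  qed
qed

text \<open>Distinct elements returning ever smaller neighbourhoods of \<open>p\<close> to
  themselves have a collapsing subsequence. If \<open>p\<close> were neither its repelling nor its
  attracting point, small neighbourhoods of \<open>p\<close> would end up near \<open>y\<close>,
  away from \<open>p\<close>. If \<open>p\<close> is repelling, inverses make it attracting.\<close>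

lemma limit_point_collapses:
  assumes p: "p \<in> limits"
  obtains f x where "collapses f x p"
proof -
  have pX: "p \<in> topspace X" using p limits_subset by blast
  obtain U :: "nat \<Rightarrow> 'p set" where "\<forall>n. openin X (U n) \<and> p \<in> U n \<and>
      (\<forall>V. openin X V \<longrightarrow> p \<in> V \<longrightarrow> (\<forall>\<^sub>F n in sequentially. U n \<subseteq> V))"
    using neighbourhood_sequence[OF pX] ..
  then have U: "openin X (U n)" "p \<in> U n"
    "openin X V \<Longrightarrow> p \<in> V \<Longrightarrow> \<forall>\<^sub>F n in sequentially. U n \<subseteq> V" for n V
    by simp_all
  obtain f where "inj f \<and> (\<forall>n. f n \<in> {g \<in> carrier G. \<phi> g ` U n \<inter> U n \<noteq> {}})"
    using injective_choice[OF limits_infinite_return[OF p U(1,2)]] ..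
  then have f: "inj f" "f n \<in> carrier G" "\<phi> (f n) ` U n \<inter> U n \<noteq> {}" for n by simp_all
  have "range f \<subseteq> carrier G" using f(2) by auto
  then obtain r x y where r: "strict_mono r" and c: "collapses (f \<circ> r) x y"
    by (rule collapsing_subsequence[OF f(1)])
  have "p = x \<or> p = y"
  proof (rule ccontr)
    assume "\<not> (p = x \<or> p = y)"
    then have "p \<noteq> x" "p \<noteq> y" by auto
    obtain U1 V1 C1 D1 where
      1: "openin X U1" "openin X V1" "closedin X C1" "closedin X D1"
        "p \<in> U1" "U1 \<subseteq> C1" "x \<in> V1" "V1 \<subseteq> D1" "C1 \<inter> D1 = {}"
      using closed_separation[OF pX collapsesD(3)[OF c] \<open>p \<noteq> x\<close>] .
    obtain U2 V2 where 2: "openin X U2" "openin X V2" "p \<in> U2" "y \<in> V2" "U2 \<inter> V2 = {}"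
      using separation[OF pX collapsesD(4)[OF c] \<open>p \<noteq> y\<close>] .
    have "x \<notin> C1" using 1 by blast
    have e1: "\<forall>\<^sub>F n in sequentially. \<phi> ((f \<circ> r) n) ` C1 \<subseteq> V2"
      by (rule collapsesD(5)[OF c 2(2,4) 1(3) \<open>x \<notin> C1\<close>])
    have "openin X (U1 \<inter> U2)" "p \<in> U1 \<inter> U2" using 1 2 by auto
    from U(3)[OF this] have "\<forall>\<^sub>F n in sequentially. U (r n) \<subseteq> U1 \<inter> U2"
      using filterlim_subseq[OF r] by (rule eventually_compose_filterlim)
    from eventually_happens[OF eventually_conj[OF e1 this]]
    obtain n where n: "\<phi> (f (r n)) ` C1 \<subseteq> V2" "U (r n) \<subseteq> U1 \<inter> U2" by auto
    from f(3)[of "r n"] have "\<phi> (f (r n)) ` C1 \<inter> U2 \<noteq> {}" using n(2) 1(6) by blast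
    with n(1) 2(5) show False by blast
  qed
  then show thesis
  proof
    assume "p = x"
    show thesis by (rule that) (use collapses_inv[OF c] \<open>p = x\<close> in simp)
  next
    assume "p = y"
    show thesis by (rule that) (use c \<open>p = y\<close> in simp)
  qed
qed

lemma limit_point_collapses_off:
  assumes "p \<in> limits"
  obtains f y where "collapses f p y"
  by (rule limit_point_collapses[OF assms], erule that[OF collapses_inv])

section \<open>Powers of one element, and separation of three points\<close>

lemma act_pow_Suc:
  assumes "h \<in> carrier G" "z \<in> topspace X"
  shows "\<phi> (h [^] Suc n) z = \<phi> h (\<phi> (h [^] n) z)"
  using assms by (simp only: nat_pow_Suc2 act_mult nat_pow_closed)

lemma act_pow_add:
  assumes "h \<in> carrier G" "z \<in> topspace X"
  shows "\<phi> (h [^] (m + n :: nat)) z = \<phi> (h [^] m) (\<phi> (h [^] n) z)"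
  using assms by (simp add: act_mult flip: nat_pow_mult)

lemma three_closed_neighbourhoods:
  assumes abc: "a \<in> topspace X" "b \<in> topspace X" "c \<in> topspace X" "a \<noteq> b" "a \<noteq> c" "b \<noteq> c"
  obtains U V W A B C where "openin X U" "openin X V" "openin X W"
    "closedin X A" "closedin X B" "closedin X C" "a \<in> U" "U \<subseteq> A" "b \<in> V" "V \<subseteq> B" "c \<in> W" "W \<subseteq> C"
    "A \<inter> B = {}" "A \<inter> C = {}" "B \<inter> C = {}"
proof -
  obtain U1 V1 A1 B1 where 1: "openin X U1" "openin X V1" "closedin X A1" "closedin X B1"
    "a \<in> U1" "U1 \<subseteq> A1" "b \<in> V1" "V1 \<subseteq> B1" "A1 \<inter> B1 = {}"
    by (rule closed_separation[OF abc(1,2,4)])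
  obtain U2 W2 A2 C2 where 2: "openin X U2" "openin X W2" "closedin X A2" "closedin X C2"
    "a \<in> U2" "U2 \<subseteq> A2" "c \<in> W2" "W2 \<subseteq> C2" "A2 \<inter> C2 = {}"
    by (rule closed_separation[OF abc(1,3,5)])
  obtain V3 W3 B3 C3 where 3: "openin X V3" "openin X W3" "closedin X B3" "closedin X C3"
    "b \<in> V3" "V3 \<subseteq> B3" "c \<in> W3" "W3 \<subseteq> C3" "B3 \<inter> C3 = {}"
    by (rule closed_separation[OF abc(2,3,6)])
  show thesis
    by (rule that[of "U1 \<inter> U2" "V1 \<inter> V3" "W2 \<inter> W3" "A1 \<inter> A2" "B1 \<inter> B3" "C2 \<inter> C3"])
      (use 1 2 3 in \<open>auto intro: openin_Int closedin_Int\<close>)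
qed

text \<open>Ping-pong with a single element: the first step lands in \<open>P\<close>, hence outside
  \<open>Q\<close>, and the hypothesis on \<open>h\<close> applies again.\<close>

lemma act_pow_attracted:
  assumes h: "h \<in> carrier G" and hP: "\<And>u. u \<in> topspace X \<Longrightarrow> u \<notin> Q \<Longrightarrow> \<phi> h u \<in> P"
    and PQ: "P \<inter> Q = {}" and u: "u \<in> topspace X" "u \<notin> Q"
  shows "\<phi> (h [^] Suc n) u \<in> P"
proof (induction n)
  case 0
  then show ?case using hP[OF u] h by simp
next
  case (Suc n)
  then have "\<phi> (h [^] Suc n) u \<notin> Q" using PQ by blast
  then have "\<phi> h (\<phi> (h [^] Suc n) u) \<in> P" using h u by (intro hP) auto
  then show ?case unfolding act_pow_Suc[OF h u(1)] .
qed

end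

text \<open>\<open>card\<close> is 0 on infinite sets, hence the separate disjunct.\<close>

locale nonelementary_convergence_action = compact_convergence_action +
  assumes nonelementary: "infinite limits \<or> card limits > 2"
begin

lemma three_limit_points:
  obtains a b c where "a \<in> limits" "b \<in> limits" "c \<in> limits" "a \<noteq> b" "a \<noteq> c" "b \<noteq> c"
proof -
  obtain T where "T \<subseteq> limits" "card T = 3"
  proof (cases "finite limits")
    case True
    then have "3 \<le> card limits" using nonelementary by simp
    then show thesis using obtain_subset_with_card_n that by metis
  next
    case False
    then show thesis using infinite_arbitrarily_large that by metis
  qed
  then show thesis using that unfolding card_3_iff by blast
qed

lemma three_limit_points_avoiding:
  obtains a b where "a \<in> limits" "b \<in> limits" "a \<noteq> b" "a \<noteq> z" "b \<noteq> z"
  using three_limit_points by metis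

section \<open>The kernel on the limit set is finite and normal\<close>

lemma finite_limit_kernel: "finite (action_kernel G limits \<phi>)"
proof (rule ccontr)
  assume inf: "infinite (action_kernel G limits \<phi>)"
  obtain f x y where f: "collapses f x y" "range f \<subseteq> action_kernel G limits \<phi>"
    by (rule infinite_collapses[OF inf]) (auto simp: action_kernel_def)
  obtain a b where ab: "a \<in> limits" "b \<in> limits" "a \<noteq> b" "a \<noteq> x" "b \<noteq> x"
    by (rule three_limit_points_avoiding)
  have "y \<in> {q}" if "q \<in> limits" "q \<noteq> x" for q
  proof (rule collapses_limit_in[OF f(1)])
    show "q \<in> topspace X" using that limits_subset by blast
    then show "closedin X {q}" by (simp add: closedin_Hausdorff_sing_eq[OF Hausdorff])
    show "\<phi> (f n) q \<in> {q}" for n using f(2) that by (auto simp: action_kernel_def)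
  qed (use that in auto)
  from this[of a] this[of b] ab show False by auto
qed

lemma limit_kernel_normal: "action_kernel G limits \<phi> \<lhd> G"
proof (rule normal_invI)
  let ?K = "action_kernel G limits \<phi>"
  have X: "q \<in> topspace X" if "q \<in> limits" for q using that limits_subset by blast
  show "subgroup ?K G"
  proof (rule subgroupI)
    show "?K \<subseteq> carrier G" by (auto simp: action_kernel_def)
    have "\<one> \<in> ?K" by (auto simp: action_kernel_def X)
    then show "?K \<noteq> {}" by blast
    show "inv g \<in> ?K" if g: "g \<in> ?K" for g
    proof -
      have "\<phi> (inv g) q = q" if "q \<in> limits" for q
        using g that act_inv_act[of g q] X[of q] by (simp add: action_kernel_def)
      then show ?thesis using g by (simp add: action_kernel_def)
    qed
    show "g \<otimes> h \<in> ?K" if "g \<in> ?K" "h \<in> ?K" for g h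
      using that by (auto simp: action_kernel_def act_mult X)
  qed
  fix x g assume x: "x \<in> carrier G" and g: "g \<in> ?K"
  have "\<phi> (x \<otimes> g \<otimes> inv x) q = q" if q: "q \<in> limits" for q
  proof -
    have "\<phi> g (\<phi> (inv x) q) = \<phi> (inv x) q"
      using g limits_invariant[of "inv x" q] x q by (simp add: action_kernel_def)
    then show ?thesis using x g q X by (simp add: act_mult action_kernel_def)
  qed
  then show "x \<otimes> g \<otimes> inv x \<in> ?K" using x g by (simp add: action_kernel_def)
qed

section \<open>Absence of global fixed points\<close>

text \<open>Suppose the orbit of \<open>u\<close> stays in \<open>Q\<close> and take a collapsing
  sequence of powers of \<open>h\<close>. One of \<open>p\<close>, \<open>p'\<close> is not
  repelling, so the attracting point is in \<open>P\<close>. As \<open>z\<close> is fixed outside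
  \<open>P\<close>, it is the repelling point; then \<open>u\<close> is not, and the attracting
  point is also in \<open>C\<close>.\<close>

lemma exists_escaping_iterate:
  assumes h: "h \<in> carrier G" and hz: "\<phi> h z = z" and hP: "\<And>u. u \<in> topspace X \<Longrightarrow> u \<notin> Q \<Longrightarrow> \<phi> h u \<in> P"
    and P: "closedin X P" and C: "closedin X C" "Q \<subseteq> C" and PC: "P \<inter> C = {}" and z: "z \<in> Q"
    and p: "p \<in> topspace X" "p \<notin> Q" and p': "p' \<in> topspace X" "p' \<notin> Q" "p' \<notin> P" and pp': "p \<noteq> p'"
    and u: "u \<in> topspace X" "u \<noteq> z"
  shows "\<exists>m. \<phi> (h [^] (m::nat)) u \<notin> Q"
proof (rule ccontr)
  assume "\<not> ?thesis"
  then have stay: "\<phi> (h [^] m) u \<in> Q" for m :: nat by blast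
  have PQ: "P \<inter> Q = {}" using PC C by blast
  have zX: "z \<in> topspace X" using z C closedin_subset by blast
  \<comment> \<open>Since \<open>p'\<close> lies outside \<open>P\<close>, positive powers of
    \<open>h\<close> move it, so \<open>h\<close> has infinite order.\<close>
  have "\<phi> (h [^] Suc m) p' \<noteq> p'" for m
    using act_pow_attracted[of h Q P p' m] h hP PQ p' by metis
  then have "h [^] e \<noteq> \<one>" if "e > 0" for e :: nat
    using that p'(1) by (metis act_one gr0_implies_Suc)
  then have "inj (\<lambda>n::nat. h [^] n)" by (rule inj_pow[OF h])
  \<comment> \<open>Exponent 0 is left out: only positive powers are known to carry points outside
    \<open>Q\<close> into \<open>P\<close>.\<close>
  then have "infinite ((\<lambda>n::nat. h [^] n) ` {1..})"
    by (metis finite_imageD infinite_Ici inj_on_subset subset_UNIV)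
  then obtain f a b where f: "collapses f a b" "range f \<subseteq> (\<lambda>n::nat. h [^] n) ` {1..}"
    by (rule infinite_collapses) (use h in auto)
  have f_pow: "\<exists>m. f n = h [^] Suc m" for n
  proof -
    obtain k :: nat where "k \<ge> 1" "f n = h [^] k" using f(2) by (metis (no_types, lifting) atLeast_iff imageE rangeI subsetD)
    then show ?thesis by (metis Suc_le_D One_nat_def)
  qed
  have fP: "\<phi> (f n) q \<in> P" if "q \<in> topspace X" "q \<notin> Q" for q n
  proof -
    have "\<phi> (h [^] Suc m) q \<in> P" for m by (rule act_pow_attracted[OF h _ PQ that]) (rule hP)
    then show ?thesis using f_pow[of n] by auto
  qed
  have "b \<in> P"
  proof (cases "p = a")
    case False
    show ?thesis by (rule collapses_limit_in[OF f(1) p(1) False P fP[OF p]])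
  next
    case True
    then have "p' \<noteq> a" using pp' by simp
    show ?thesis by (rule collapses_limit_in[OF f(1) p'(1) \<open>p' \<noteq> a\<close> P fP[OF p'(1,2)]])
  qed
  have pow_z: "\<phi> (h [^] (m::nat)) z = z" for m
  proof (induction m)
    case (Suc m)
    then show ?case unfolding act_pow_Suc[OF h zX] by (simp add: hz)
  qed (simp add: zX)
  have "z = a"
  proof (rule ccontr)
    assume "z \<noteq> a"
    have "\<phi> (f n) z \<in> {z}" for n using f_pow[of n] pow_z by (metis singletonI)
    then have "b \<in> {z}"
      by (rule collapses_limit_in[OF f(1) zX \<open>z \<noteq> a\<close>, rotated])
        (simp add: closedin_Hausdorff_sing_eq[OF Hausdorff] zX)
    with \<open>b \<in> P\<close> z PQ show False by blast
  qed
  with u(2) have "u \<noteq> a" by simp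
  have "\<phi> (f n) u \<in> C" for n using f_pow[of n] stay C(2) by (metis subsetD)
  then have "b \<in> C" by (rule collapses_limit_in[OF f(1) u(1) \<open>u \<noteq> a\<close> C(1)])
  with \<open>b \<in> P\<close> PC show False by blast
qed

text \<open>Two elements h and h' attracting towards different limit points p and p' would both repel from
  the fixed point z. A point carried close to z by a high power of the inverse of h' can be brought
  back to a fixed compact region by a power of h, while points near p' end up near p. As z stays
  fixed, three points remain separated, so only finitely many of these products are distinct and
  h' has a power in common with h, which is absurd.\<close>

lemma no_global_fixed_point:
  assumes zX: "z \<in> topspace X" and fixed: "\<And>g. g \<in> carrier G \<Longrightarrow> \<phi> g z = z"
  shows False
proof -
  have closed_z: "closedin X {z}" by (simp add: closedin_Hausdorff_sing_eq[OF Hausdorff] zX)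
  \<comment> \<open>If the fixed point \<open>z\<close> were not repelling, its constant images
    would converge to \<open>q\<close>.\<close>
  have attract: "\<exists>f. collapses f z q" if "q \<in> limits" "q \<noteq> z" for q
  proof -
    obtain f x where f: "collapses f x q" by (rule limit_point_collapses[OF \<open>q \<in> limits\<close>])
    have "x = z"
    proof (rule ccontr)
      assume "x \<noteq> z"
      then have "z \<noteq> x" by simp
      have "q \<in> {z}"
        by (rule collapses_limit_in[OF f zX \<open>z \<noteq> x\<close> closed_z]) (simp add: fixed[OF collapsesD(2)[OF f]])
      with that show False by simp
    qed
    with f show ?thesis by blast
  qed
  obtain p p' where pp': "p \<in> limits" "p' \<in> limits" "p \<noteq> p'" "p \<noteq> z" "p' \<noteq> z"
    by (rule three_limit_points_avoiding)
  have pX: "p \<in> topspace X" "p' \<in> topspace X" using pp' limits_subset by auto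
  obtain Q V V' C P P' where
    Q: "openin X Q" "openin X V" "openin X V'" "closedin X C" "closedin X P" "closedin X P'"
      "z \<in> Q" "Q \<subseteq> C" "p \<in> V" "V \<subseteq> P" "p' \<in> V'" "V' \<subseteq> P'"
      "C \<inter> P = {}" "C \<inter> P' = {}" "P \<inter> P' = {}"
    by (rule three_closed_neighbourhoods[OF zX pX not_sym[OF pp'(4)] not_sym[OF pp'(5)] pp'(3)])
  note sub = closedin_subset[OF Q(4)] closedin_subset[OF Q(5)] closedin_subset[OF Q(6)]
  obtain f where f: "collapses f z p" using attract pp' by blast
  obtain i where i: "\<phi> (f i) ` (topspace X - Q) \<subseteq> V" by (rule collapses_set[OF f Q(2,9,1,7)])
  define h where "h = f i"
  have h: "h \<in> carrier G" unfolding h_def by (rule collapsesD(2)[OF f])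
  have hP: "\<phi> h u \<in> P" if "u \<in> topspace X" "u \<notin> Q" for u
    using i that Q(10) unfolding h_def by blast
  \<comment> \<open>Points of \<open>Q1\<close> remain in \<open>Q\<close> for one step of
    \<open>h\<close>, so their first exit time \<open>m\<close> is at least 2. The first
    \<open>m - 1\<close> steps then already carry points of \<open>P'\<close> into
    \<open>P\<close>.\<close>
  define Q1 where "Q1 = Q \<inter> \<phi> (inv h) ` Q"
  have Q1: "openin X Q1" unfolding Q1_def using Q(1) h by (simp add: openin_Int openin_act)
  have zQ1: "z \<in> Q1"
    unfolding Q1_def using Q(7) fixed[of "inv h"] h by (metis IntI imageI inv_closed)
  have Q1_iff: "u \<in> Q1 \<longleftrightarrow> u \<in> Q \<and> \<phi> h u \<in> Q" if "u \<in> topspace X" for u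
    unfolding Q1_def using act_in_image_iff[of "inv h" Q u] h that sub(1) Q(8) by auto
  obtain f' where f': "collapses f' z p'" using attract pp' by blast
  obtain i' where i': "\<phi> (f' i') ` (topspace X - Q1) \<subseteq> V'" by (rule collapses_set[OF f' Q(3,11) Q1 zQ1])
  define h' where "h' = f' i'"
  have h': "h' \<in> carrier G" unfolding h'_def by (rule collapsesD(2)[OF f'])
  have hP': "\<phi> h' u \<in> P'" if "u \<in> topspace X" "u \<notin> Q1" for u
    using i' that Q(12) unfolding h'_def by blast
  have disj: "P \<inter> Q = {}" "P' \<inter> Q1 = {}" using Q(8,13,14) unfolding Q1_def by auto
  have pow: "\<phi> (h [^] Suc n) u \<in> P" if "u \<in> topspace X" "u \<notin> Q" for u n
    by (rule act_pow_attracted[OF h _ disj(1) that]) (rule hP)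
  have pow': "\<phi> (h' [^] Suc n) u \<in> P'" if "u \<in> topspace X" "u \<notin> Q1" for u n
    by (rule act_pow_attracted[OF h' _ disj(2) that]) (rule hP')
  have notQ: "p \<notin> Q" "p' \<notin> Q" "p \<notin> Q1" "p' \<notin> Q1" "p \<in> P" "p' \<in> P'"
    using Q(8-14) unfolding Q1_def by auto
  have pow_P: "\<phi> (h [^] (n::nat)) p \<in> P" for n
    using pow[OF pX(1) notQ(1)] notQ(5) pX by (cases n) auto

  \<comment> \<open>Compactness gives a point \<open>r\<close> all of whose backward iterates under
    \<open>h'\<close> stay in \<open>P'\<close>, since the images of \<open>P'\<close> under powers
    of \<open>h'\<close> are nested.\<close>
  define R where "R = (\<Inter>n::nat. \<phi> (h' [^] n) ` P')"
  have "R \<noteq> {}" unfolding R_def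
  proof (rule compact_space_imp_nest[OF compact])
    fix n :: nat
    show "closedin X (\<phi> (h' [^] n) ` P')" using h' Q(6) by (intro closedin_act) auto
    show "\<phi> (h' [^] n) ` P' \<noteq> {}" using notQ(6) by blast
  next
    show "decseq (\<lambda>n::nat. \<phi> (h' [^] n) ` P')"
    proof (rule decseq_SucI, rule image_subsetI)
      fix n :: nat and u assume u: "u \<in> P'"
      then have uX: "u \<in> topspace X" using sub by blast
      have "\<phi> (h' [^] Suc n) u = \<phi> (h' [^] n) (\<phi> h' u)" using h' uX by (simp add: act_mult)
      moreover have "\<phi> h' u \<in> P'" using hP' uX u disj(2) by blast
      ultimately show "\<phi> (h' [^] Suc n) u \<in> \<phi> (h' [^] n) ` P'" by blast
    qed
  qed
  then obtain r where r: "\<And>n::nat. r \<in> \<phi> (h' [^] n) ` P'" unfolding R_def by blast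
  have rP': "r \<in> P'" using r[of 0] sub by (auto simp: subset_iff)
  then have rX: "r \<in> topspace X" using sub by blast
  have r_back: "\<phi> (inv (h' [^] n)) r \<in> P'" for n :: nat
    using r[of n] act_in_image_iff[of "h' [^] n" P' r] h' sub rX by simp

  \<comment> \<open>\<open>D\<close> is closed, misses \<open>z\<close>, and contains the first
    point outside \<open>Q\<close> of any \<open>h\<close>-orbit that starts in
    \<open>Q\<close>.\<close>
  define D where "D = \<phi> h ` C \<inter> (topspace X - Q)"
  define F where "F = {g \<in> carrier G. \<phi> g p \<in> D \<and> \<phi> g r \<in> \<phi> h ` P}"
  have D: "closedin X D" unfolding D_def using Q h by (intro closedin_Int closedin_act closedin_diff) auto
  have E: "closedin X (\<phi> h ` P)" using Q h by (intro closedin_act) auto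
  have zD: "z \<notin> D" unfolding D_def using Q(7) by blast
  have zE: "z \<notin> \<phi> h ` P"
    using act_in_image_iff[OF h sub(2) zX] fixed[of "inv h"] h Q(7) disj(1) by auto
  have DE: "D \<inter> \<phi> h ` P = {}"
  proof -
    have "inj_on (\<phi> h) (C \<union> P)"
      using inj_prop[OF h] sub by (blast intro: inj_on_subset)
    then have "\<phi> h ` (C \<inter> P) = \<phi> h ` C \<inter> \<phi> h ` P" by (rule inj_on_image_Int) auto
    then show ?thesis using Q(13) unfolding D_def by auto
  qed
  \<comment> \<open>A collapsing sequence in \<open>F\<close> would bring at least two of the
    distinct points \<open>z\<close>, \<open>p\<close>, \<open>r\<close> to its attracting point,
    but their images stay in the pairwise disjoint closed sets \<open>{z}\<close>, \<open>D\<close>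
    and \<open>\<phi> h\<close> followed by \<open>P\<close>.\<close>
  have "finite F"
  proof (rule ccontr)
    assume "infinite F"
    then obtain f a b where f: "collapses f a b" "range f \<subseteq> F"
      by (rule infinite_collapses) (auto simp: F_def)
    have fF: "f n \<in> F" for n using f(2) by blast
    have 1: "b = z" if "z \<noteq> a"
    proof -
      have "b \<in> {z}" by (rule collapses_limit_in[OF f(1) zX that closed_z]) (simp add: fixed[OF collapsesD(2)[OF f(1)]])
      then show ?thesis by simp
    qed
    have 2: "b \<in> D" if "p \<noteq> a"
      by (rule collapses_limit_in[OF f(1) pX(1) that D]) (use fF in \<open>simp add: F_def\<close>)
    have 3: "b \<in> \<phi> h ` P" if "r \<noteq> a"
      by (rule collapses_limit_in[OF f(1) rX that E]) (use fF in \<open>simp add: F_def\<close>)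
    have "p \<noteq> r" "z \<noteq> r" using notQ(5) rP' Q(7,8,14,15) by auto
    with 1 2 3 zD zE DE pp'(4) show False by blast
  qed
  have "\<exists>m::nat. h [^] m \<otimes> inv (h' [^] Suc k) \<in> F" for k
  proof -
    \<comment> \<open>\<open>u\<close> lies in \<open>Q1\<close>, as otherwise \<open>h'\<close>
      would have carried it into \<open>P'\<close> rather than to \<open>p\<close>. The exponent
      \<open>m\<close> below is its first exit time from \<open>Q\<close> under
      \<open>h\<close>.\<close>
    define u where "u = \<phi> (inv (h' [^] Suc k)) p"
    have hk: "h' [^] Suc k \<in> carrier G" using h' by simp
    have uX: "u \<in> topspace X" unfolding u_def using hk pX by simp
    have hku: "\<phi> (h' [^] Suc k) u = p" unfolding u_def by (rule act_act_inv[OF hk pX(1)])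
    have "u \<in> Q1"
    proof (rule ccontr)
      assume "u \<notin> Q1"
      from pow'[OF uX this, of k] hku notQ(5) Q(15) show False by auto
    qed
    have "u \<noteq> z" using hku fixed[OF hk] pp'(4) by auto
    have "\<exists>m. \<phi> (h [^] (m::nat)) u \<notin> Q"
      by (rule exists_escaping_iterate[OF h fixed[OF h] hP Q(5,4,8) _ Q(7) pX(1) notQ(1) pX(2) notQ(2) _ pp'(3) uX \<open>u \<noteq> z\<close>])
        (use Q notQ in auto)
    then obtain m :: nat where m: "\<phi> (h [^] m) u \<notin> Q" "\<And>j. j < m \<Longrightarrow> \<phi> (h [^] j) u \<in> Q"
      using exists_least_iff[of "\<lambda>m. \<phi> (h [^] m) u \<notin> Q"] by blast
    have "\<phi> (h [^] (0::nat)) u \<in> Q" "\<phi> (h [^] Suc 0) u \<in> Q"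
      using \<open>u \<in> Q1\<close> Q1_iff[OF uX] uX h by auto
    then have "m \<noteq> 0" "m \<noteq> Suc 0" using m(1) by metis+
    then obtain j where j: "m = Suc (Suc j)" by (metis not0_implies_Suc)
    have "\<phi> (h [^] m) u \<in> \<phi> h ` C"
      unfolding j act_pow_Suc[OF h uX, of "Suc j"] using m(2)[of "Suc j"] Q(8) j by blast
    then have "\<phi> (h [^] m) u \<in> D" unfolding D_def using m(1) uX h by simp
    moreover have "\<phi> (h [^] m) (\<phi> (inv (h' [^] Suc k)) r) \<in> \<phi> h ` P"
    proof -
      let ?v = "\<phi> (inv (h' [^] Suc k)) r"
      have v: "?v \<in> topspace X" "?v \<notin> Q" using r_back[of "Suc k"] sub Q(8,14) by auto
      show ?thesis unfolding j act_pow_Suc[OF h v(1), of "Suc j"] using pow[OF v, of j] by blast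
    qed
    ultimately have "h [^] m \<otimes> inv (h' [^] Suc k) \<in> F"
      unfolding F_def u_def using h hk pX rX by (simp add: act_mult del: nat_pow_Suc)
    then show ?thesis ..
  qed
  then obtain m :: "nat \<Rightarrow> nat" where m: "\<And>k. h [^] m k \<otimes> inv (h' [^] Suc k) \<in> F" by metis
  then have "range (\<lambda>k. h [^] m k \<otimes> inv (h' [^] Suc k)) \<subseteq> F" by blast
  then have "finite (range (\<lambda>k. h [^] m k \<otimes> inv (h' [^] Suc k)))"
    using \<open>finite F\<close> by (rule finite_subset)
  then have not_inj: "\<not> inj (\<lambda>k. h [^] m k \<otimes> inv (h' [^] Suc k))"
    by (meson range_inj_infinite)
  have "\<exists>k l. k < l \<and> h [^] m k \<otimes> inv (h' [^] Suc k) = h [^] m l \<otimes> inv (h' [^] Suc l)"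
    using linorder_injI[of "\<lambda>k. h [^] m k \<otimes> inv (h' [^] Suc k)"] not_inj by blast
  then obtain k l where kl: "k < l" "h [^] m k \<otimes> inv (h' [^] Suc k) = h [^] m l \<otimes> inv (h' [^] Suc l)"
    by blast
  \<comment> \<open>\<open>Suc e\<close> equals \<open>l - k\<close>; cancelling the common powers
    of \<open>h'\<close> expresses the action of \<open>h' [^] Suc e\<close> through powers of
    \<open>h\<close>.\<close>
  define e where "e = l - Suc k"
  have l: "Suc l = Suc k + Suc e" using kl(1) by (simp add: e_def)
  have eq: "\<phi> (h [^] m k) (\<phi> (h' [^] Suc e) v) = \<phi> (h [^] m l) v" if v: "v \<in> topspace X" for v
  proof -
    let ?w = "\<phi> (h' [^] Suc l) v"
    have "\<phi> (inv (h' [^] Suc k)) ?w = \<phi> (h' [^] Suc e) v"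
      unfolding l act_pow_add[OF h' v] using h' v by (simp del: nat_pow_Suc)
    moreover have "\<phi> (inv (h' [^] Suc l)) ?w = v" using h' v by (simp del: nat_pow_Suc)
    moreover have "\<phi> (h [^] m k \<otimes> inv (h' [^] Suc k)) ?w = \<phi> (h [^] m l \<otimes> inv (h' [^] Suc l)) ?w"
      by (simp only: kl(2))
    ultimately show ?thesis using h h' v by (simp add: act_mult del: nat_pow_Suc)
  qed
  \<comment> \<open>If the resulting power of \<open>h\<close> is non-negative, it keeps
    \<open>p\<close> in \<open>P\<close> while \<open>h'\<close> sends \<open>p\<close> into
    \<open>P'\<close>. If it is negative, a positive power of \<open>h\<close> takes a point of
    \<open>P'\<close> to \<open>p'\<close>, although it must land in \<open>P\<close>.\<close>
  show False
  proof (cases "m k \<le> m l")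
    case True
    then have "\<phi> (h [^] m l) p = \<phi> (h [^] m k) (\<phi> (h [^] (m l - m k)) p)"
      using act_pow_add[OF h pX(1), of "m k" "m l - m k"] by simp
    with eq[OF pX(1)] have "\<phi> (h' [^] Suc e) p = \<phi> (h [^] (m l - m k)) p"
      using h h' pX by (simp del: nat_pow_Suc)
    with pow'[OF pX(1) notQ(3), of e] pow_P[of "m l - m k"] Q(15) show False by auto
  next
    case False
    let ?v = "\<phi> (h' [^] Suc e) p'"
    have v: "?v \<in> topspace X" "?v \<notin> Q"
      using pow'[OF pX(2) notQ(4), of e] sub Q(8,14) by auto
    obtain c where c: "m k - m l = Suc c" using False by (metis Suc_diff_Suc not_le)
    then have "m k = m l + Suc c" by simp
    with eq[OF pX(2)] have "\<phi> (h [^] m l) (\<phi> (h [^] Suc c) ?v) = \<phi> (h [^] m l) p'"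
      using act_pow_add[OF h v(1), of "m l" "Suc c"] by simp
    then have "\<phi> (h [^] Suc c) ?v = p'" using h v pX by (simp del: nat_pow_Suc)
    with pow[OF v, of c] notQ(6) Q(15) show False by auto
  qed
qed

text \<open>By normality, a point fixed by \<open>N\<close> has its whole \<open>G\<close>-orbit
  fixed by \<open>N\<close>. Orbit points other than the repelling point \<open>x\<close> are
  carried into \<open>W\<close>, where \<open>n0\<close> moves every point. So the orbit is
  \<open>x\<close> alone, a global fixed point.\<close>

lemma normal_fixed_point_free:
  assumes N: "N \<lhd> G" and n0: "n0 \<in> N" and p: "p \<in> limits" "\<phi> n0 p \<noteq> p" and y: "y \<in> topspace X"
  shows "\<exists>n\<in>N. \<phi> n y \<noteq> y"
proof (rule ccontr)
  assume "\<not> ?thesis"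
  then have Ny: "\<And>n. n \<in> N \<Longrightarrow> \<phi> n y = y" by blast
  have NG: "n \<in> carrier G" if "n \<in> N" for n using N that normal_imp_subgroup subgroup.mem_carrier by metis
  have Norb: "\<phi> n (\<phi> g y) = \<phi> g y" if "n \<in> N" "g \<in> carrier G" for n g
  proof -
    have "inv g \<otimes> n \<otimes> g \<in> N" using N that by (simp add: normal.inv_op_closed1)
    then have "\<phi> g (\<phi> (inv g \<otimes> n \<otimes> g) y) = \<phi> g y" by (simp add: Ny)
    then show ?thesis using that y NG by (simp add: act_mult)
  qed
  have pX: "p \<in> topspace X" using p limits_subset by blast
  obtain f x where f: "collapses f x p" by (rule limit_point_collapses[OF p(1)])
  obtain W where W: "openin X W" "p \<in> W" "\<phi> n0 ` W \<inter> W = {}"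
    by (rule displaced_neighbourhood[OF NG[OF n0] pX p(2)])
  have x: "\<phi> g y = x" if g: "g \<in> carrier G" for g
  proof (rule ccontr)
    assume "\<phi> g y \<noteq> x"
    from collapses_point_eventually[OF f act_closed[OF g y] this W(1,2)]
    obtain i where i: "\<phi> (f i) (\<phi> g y) \<in> W" using eventually_happens by fastforce
    have "\<phi> n0 (\<phi> (f i) (\<phi> g y)) = \<phi> (f i) (\<phi> g y)"
      using Norb[OF n0, of "f i \<otimes> g"] g y collapsesD(2)[OF f, of i] by (simp add: act_mult)
    with i W(3) show False by (metis IntI empty_iff imageI)
  qed
  have "y = x" using x[OF one_closed] y by simp
  then show False using no_global_fixed_point[OF y] x by blast
qed

text \<open>The element is a conjugate of some \<open>n\<close> in \<open>N\<close> moving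
  \<open>y\<close>: \<open>t\<close> sends the complement of \<open>Q\<close> into \<open>W\<close>
  near \<open>y\<close>, \<open>n\<close> moves \<open>W\<close> off itself, and
  \<open>inv t\<close> brings everything outside \<open>W\<close> into \<open>Q\<close>.\<close>

lemma normal_contracting_element:
  assumes N: "N \<lhd> G" and n0: "n0 \<in> N" "p \<in> limits" "\<phi> n0 p \<noteq> p"
    and q: "q \<in> limits" and Q: "openin X Q" "q \<in> Q"
  obtains n where "n \<in> N" "\<phi> n ` (topspace X - Q) \<subseteq> Q"
proof -
  have NG: "n \<in> carrier G" if "n \<in> N" for n using N that normal_imp_subgroup subgroup.mem_carrier by metis
  obtain f y where f: "collapses f q y" by (rule limit_point_collapses_off[OF q])
  obtain n where n: "n \<in> N" "\<phi> n y \<noteq> y"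
    using normal_fixed_point_free[OF N n0 collapsesD(4)[OF f]] by blast
  obtain W where W: "openin X W" "y \<in> W" "\<phi> n ` W \<inter> W = {}"
    by (rule displaced_neighbourhood[OF NG[OF n(1)] collapsesD(4)[OF f] n(2)])
  obtain i where i: "\<phi> (f i) ` (topspace X - Q) \<subseteq> W" by (rule collapses_set[OF f W(1,2) Q])
  define t where "t = f i"
  have t: "t \<in> carrier G" unfolding t_def by (rule collapsesD(2)[OF f])
  show thesis
  proof (rule that)
    show "inv t \<otimes> n \<otimes> t \<in> N" using N n t by (simp add: normal.inv_op_closed1)
    show "\<phi> (inv t \<otimes> n \<otimes> t) ` (topspace X - Q) \<subseteq> Q"
    proof (rule image_subsetI)
      fix u assume "u \<in> topspace X - Q"
      then have u: "u \<in> topspace X" "u \<notin> Q" by auto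
      let ?v = "\<phi> (inv t \<otimes> n \<otimes> t) u"
      have v: "?v \<in> topspace X" using t n NG u by simp
      have "\<phi> t ?v = \<phi> n (\<phi> t u)" using t n NG u by (simp add: act_mult)
      moreover have "\<phi> t u \<in> W" using i u unfolding t_def by blast
      ultimately have "\<phi> t ?v \<notin> W" using W(3) by blast
      then show "?v \<in> Q" using i v unfolding t_def by blast
    qed
  qed
qed

end

section \<open>Finite and amenable normal subgroups\<close>

text \<open>The mean is the normalised counting measure.\<close>

lemma (in group) amenable_finite_subgroup:
  assumes H: "subgroup H G" and fin: "finite H"
  shows "amenable (G\<lparr>carrier := H\<rparr>)"
proof -
  let ?\<mu> = "\<lambda>A. real (card A) / real (card H)"
  have pos: "card H > 0" using fin subgroup.one_closed[OF H] by (auto simp: card_gt_0_iff)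
  have "?\<mu> (A \<union> B) = ?\<mu> A + ?\<mu> B" if "A \<subseteq> H" "B \<subseteq> H" "A \<inter> B = {}" for A B
    using that fin by (simp add: card_Un_disjoint finite_subset add_divide_distrib)
  moreover have "?\<mu> (g <#\<^bsub>G\<lparr>carrier := H\<rparr>\<^esub> A) = ?\<mu> A" if "g \<in> H" "A \<subseteq> H" for g A
  proof -
    have "g <#\<^bsub>G\<lparr>carrier := H\<rparr>\<^esub> A = (\<otimes>) g ` A" by (auto simp: l_coset_def)
    moreover have "inj_on ((\<otimes>) g) A"
      using that subgroup.mem_carrier[OF H] by (intro inj_onI) (metis Units_eq Units_l_cancel subsetD)
    ultimately show ?thesis by (simp add: card_image)
  qed
  ultimately show ?thesis
    unfolding amenable_def using pos by (intro exI[of _ ?\<mu>]) auto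
qed

lemma (in group) normal_finite_subset_FC_center:
  assumes N: "N \<lhd> G" and fin: "finite N"
  shows "N \<subseteq> FC_center G"
proof
  fix n assume n: "n \<in> N"
  have "{inv x \<otimes> n \<otimes> x | x. x \<in> carrier G} \<subseteq> N"
    using normal.inv_op_closed1[OF N _ n] by blast
  then have "finite {inv x \<otimes> n \<otimes> x | x. x \<in> carrier G}" using fin by (rule finite_subset)
  moreover have "n \<in> carrier G"
    using n N normal_imp_subgroup subgroup.mem_carrier by metis
  ultimately show "n \<in> FC_center G" unfolding FC_center_def by blast
qed

context nonelementary_convergence_action
begin

lemma amenable_normal_subset_limit_kernel:
  assumes N: "N \<lhd> G" and am: "amenable (G\<lparr>carrier := N\<rparr>)"
  shows "N \<subseteq> action_kernel G limits \<phi>"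
proof (rule ccontr)
  assume notsub: "\<not> N \<subseteq> action_kernel G limits \<phi>"
  have NG: "n \<in> carrier G" if "n \<in> N" for n
    using N that normal_imp_subgroup subgroup.mem_carrier by metis
  have Nm: "m \<otimes> n \<in> N" if "m \<in> N" "n \<in> N" for m n
    using N that normal_imp_subgroup subgroup.m_closed by metis
  obtain n0 p where n0: "n0 \<in> N" "p \<in> limits" "\<phi> n0 p \<noteq> p"
    using notsub NG unfolding action_kernel_def by blast
  obtain \<mu> where \<mu>: "\<forall>A. A \<subseteq> N \<longrightarrow> 0 \<le> (\<mu> A :: real)" "\<mu> N = 1"
    "\<forall>A B. A \<subseteq> N \<and> B \<subseteq> N \<and> A \<inter> B = {} \<longrightarrow> \<mu> (A \<union> B) = \<mu> A + \<mu> B"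
    "\<forall>g\<in>N. \<forall>A. A \<subseteq> N \<longrightarrow> \<mu> (g <#\<^bsub>G\<lparr>carrier := N\<rparr>\<^esub> A) = \<mu> A"
    using am unfolding amenable_def by auto
  have add: "\<mu> (A \<union> B) = \<mu> A + \<mu> B" if "A \<subseteq> N" "B \<subseteq> N" "A \<inter> B = {}" for A B
    using \<mu>(3) that by blast
  have mono: "\<mu> A \<le> \<mu> B" if "A \<subseteq> B" "B \<subseteq> N" for A B
  proof -
    have "\<mu> (A \<union> (B - A)) = \<mu> A + \<mu> (B - A)" using that by (intro add) auto
    moreover have "\<mu> (B - A) \<ge> 0" using \<mu>(1) that by blast
    moreover have "A \<union> (B - A) = B" using that by blast
    ultimately show ?thesis by simp
  qed
  obtain a b c where abc: "a \<in> limits" "b \<in> limits" "c \<in> limits" "a \<noteq> b" "a \<noteq> c" "b \<noteq> c"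
    by (rule three_limit_points)
  have aX: "a \<in> topspace X" "b \<in> topspace X" "c \<in> topspace X" using abc limits_subset by auto
  \<comment> \<open>Preimages under the orbit map of \<open>a\<close> turn the mean on
    \<open>N\<close> into one on subsets of the space.\<close>
  define visits where "visits Q = {k \<in> N. \<phi> k a \<in> Q}" for Q
  \<comment> \<open>A contracting \<open>n\<close> translates the complement of
    \<open>visits Q\<close> into \<open>visits Q\<close>; the complement thus has no larger measure,
    and the two measures add up to 1.\<close>
  have half: "\<mu> (visits Q) \<ge> 1 / 2" if q: "q \<in> limits" and Q: "openin X Q" "q \<in> Q" for q Q
  proof -
    obtain n where n: "n \<in> N" "\<phi> n ` (topspace X - Q) \<subseteq> Q"
      by (rule normal_contracting_element[OF N n0 q Q])
    have sub: "visits Q \<subseteq> N" unfolding visits_def by blast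
    have "n \<otimes> k \<in> visits Q" if "k \<in> N" "\<phi> k a \<notin> Q" for k
      using n that Nm NG aX(1) by (force simp: visits_def act_mult)
    then have "n <#\<^bsub>G\<lparr>carrier := N\<rparr>\<^esub> (N - visits Q) \<subseteq> visits Q"
      by (auto simp: l_coset_def visits_def)
    then have "\<mu> (n <#\<^bsub>G\<lparr>carrier := N\<rparr>\<^esub> (N - visits Q)) \<le> \<mu> (visits Q)" using sub by (rule mono)
    moreover have "\<mu> (n <#\<^bsub>G\<lparr>carrier := N\<rparr>\<^esub> (N - visits Q)) = \<mu> (N - visits Q)"
      using \<mu>(4) n(1) by blast
    moreover have "\<mu> (visits Q \<union> (N - visits Q)) = \<mu> (visits Q) + \<mu> (N - visits Q)"
      using sub by (intro add) auto
    moreover have "visits Q \<union> (N - visits Q) = N" using sub by blast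
    ultimately show ?thesis using \<mu>(2) by simp
  qed
  obtain U V W A B C where Q: "openin X U" "openin X V" "openin X W"
    "closedin X A" "closedin X B" "closedin X C" "a \<in> U" "U \<subseteq> A" "b \<in> V" "V \<subseteq> B" "c \<in> W" "W \<subseteq> C"
    "A \<inter> B = {}" "A \<inter> C = {}" "B \<inter> C = {}"
    by (rule three_closed_neighbourhoods[OF aX abc(4,5,6)])
  have vN: "visits S \<subseteq> N" for S unfolding visits_def by blast
  have "\<mu> (visits U \<union> visits V) = \<mu> (visits U) + \<mu> (visits V)"
    by (rule add[OF vN vN]) (use Q in \<open>auto simp: visits_def\<close>)
  moreover have "\<mu> ((visits U \<union> visits V) \<union> visits W) = \<mu> (visits U \<union> visits V) + \<mu> (visits W)"
    by (rule add[OF Un_least[OF vN vN] vN]) (use Q in \<open>auto simp: visits_def\<close>)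
  moreover have "\<mu> ((visits U \<union> visits V) \<union> visits W) \<le> \<mu> N"
    by (rule mono[OF Un_least[OF Un_least[OF vN vN] vN] order_refl])
  moreover note half[OF abc(1) Q(1,7)] half[OF abc(2) Q(2,9)] half[OF abc(3) Q(3,11)] \<mu>(2)
  ultimately show False by linarith
qed

end

section \<open>Linear growth of conjugates and the cone\<close>

text \<open>Along an orbit of t the set P comes before Q, with at most one step in between. The last index
  in P is a coarse coordinate, and multiplication by a generator s on the right moves it by at most
  the number of elements g in Q with gs in P, plus one.\<close>

lemma (in group) word_length_coarse_lower_bound:
  assumes S: "finite S" "S \<subseteq> carrier G" "generate G S = carrier G"
    and PQ: "P \<inter> Q = {}" and t: "t \<in> carrier G" and tpow: "\<And>e::nat. e > 0 \<Longrightarrow> t [^] e \<noteq> \<one>"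
    and cover: "\<And>g. g \<in> carrier G \<Longrightarrow> g \<in> P \<or> t \<otimes> g \<in> Q"
    and fin: "\<And>s. s \<in> carrier G \<Longrightarrow> finite {g \<in> carrier G. g \<in> Q \<and> g \<otimes> s \<in> P}"
  shows "\<exists>D. \<forall>a\<in>carrier G. \<forall>w\<in>carrier G. \<forall>n. a \<in> Q \<longrightarrow> t [^] n \<otimes> a \<otimes> w \<in> P \<longrightarrow> n \<le> D * word_length G S w"
proof -
  let ?S = "S \<union> m_inv G ` S"
  let ?F = "\<lambda>s. {g \<in> carrier G. g \<in> Q \<and> g \<otimes> s \<in> P}"
  have SG: "?S \<subseteq> carrier G" using S(2) by auto
  have "finite ?S" using S(1) by simp
  define D where "D = Suc (\<Sum>s\<in>?S. card (?F s))"
  have card_F: "card (?F s) < D" if "s \<in> ?S" for s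
    unfolding D_def using member_le_sum[OF that, of "\<lambda>s. card (?F s)"] \<open>finite ?S\<close> by (simp add: le_imp_less_Suc)
  \<comment> \<open>By \<open>cover\<close> and \<open>PQ\<close>, applying \<open>t\<close>
    preserves \<open>Q\<close>, and going back along a \<open>t\<close>-orbit preserves
    \<open>P\<close>.\<close>
  have tQ1: "t \<otimes> g \<in> Q" if "g \<in> carrier G" "g \<in> Q" for g using cover[of g] that PQ by blast
  have pow_Suc: "t [^] Suc n \<otimes> g = t \<otimes> (t [^] n \<otimes> g)" if "g \<in> carrier G" for g and n :: nat
    unfolding nat_pow_Suc2[OF t] using t that by (simp add: m_assoc)
  have tQ: "t [^] n \<otimes> g \<in> Q" if "g \<in> carrier G" "g \<in> Q" for g and n :: nat
  proof (induction n)
    case (Suc n)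
    show ?case unfolding pow_Suc[OF that(1)] by (rule tQ1[OF _ Suc]) (use t that in simp)
  qed (use that in simp)
  have tP: "t [^] m \<otimes> g \<in> P" if "g \<in> carrier G" "t [^] n \<otimes> g \<in> P" "m \<le> n" for g and m n :: nat
    using that(3,2)
  proof (induction rule: dec_induct)
    case (step k)
    have "t \<otimes> (t [^] k \<otimes> g) \<in> P" using step.prems pow_Suc[OF that(1)] by simp
    then have "t [^] k \<otimes> g \<in> P" using cover[of "t [^] k \<otimes> g"] PQ t that(1) by auto
    then show ?case by (rule step.IH)
  qed
  have inj: "inj (\<lambda>n::nat. t [^] n)" using t tpow by (rule inj_pow)
  \<comment> \<open>Otherwise the \<open>D\<close> distinct elements
    \<open>t [^] i \<otimes> a\<close> with \<open>i < D\<close> all lie in \<open>Q\<close> and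
    enter \<open>P\<close> after multiplication by \<open>s\<close>, whereas \<open>?F s\<close> has
    fewer than \<open>D\<close> elements.\<close>
  have step: "t [^] D \<otimes> (a \<otimes> s) \<in> Q" if a: "a \<in> carrier G" "a \<in> Q" and s: "s \<in> ?S" for a s
  proof (rule ccontr)
    assume notQ: "t [^] D \<otimes> (a \<otimes> s) \<notin> Q"
    have sG: "s \<in> carrier G" using s SG by blast
    obtain c where c: "D = Suc c" unfolding D_def by blast
    have "t \<otimes> (t [^] c \<otimes> (a \<otimes> s)) = t [^] D \<otimes> (a \<otimes> s)"
      unfolding c by (rule pow_Suc[symmetric]) (use a sG in simp)
    then have P: "t [^] c \<otimes> (a \<otimes> s) \<in> P" using cover[of "t [^] c \<otimes> (a \<otimes> s)"] notQ t a sG by auto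
    have "(\<lambda>i::nat. t [^] i \<otimes> a) ` {..c} \<subseteq> ?F s"
    proof (rule image_subsetI)
      fix i assume "i \<in> {..c}"
      then have "t [^] i \<otimes> (a \<otimes> s) \<in> P" using tP[OF _ P] a sG by simp
      then show "t [^] i \<otimes> a \<in> ?F s" using tQ[OF a] a t sG by (simp add: m_assoc)
    qed
    then have "card ((\<lambda>i::nat. t [^] i \<otimes> a) ` {..c}) \<le> card (?F s)"
      by (rule card_mono[OF fin[OF sG]])
    moreover have "inj_on (\<lambda>i::nat. t [^] i \<otimes> a) {..c}"
      using inj t a by (auto simp: inj_on_def)
    ultimately have "Suc c \<le> card (?F s)" by (simp add: card_image)
    with card_F[OF s] c show False by simp
  qed
  \<comment> \<open>Each letter \<open>s\<close> is traded for \<open>D\<close> powers of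
    \<open>t\<close>: \<open>a\<close> becomes \<open>t [^] D \<otimes> (a \<otimes> s)\<close>,
    still in \<open>Q\<close>, and \<open>n\<close> drops by \<open>D\<close>.\<close>
  have words: "n \<le> D * length ws"
    if "set ws \<subseteq> ?S" "a \<in> carrier G" "a \<in> Q" "t [^] n \<otimes> (a \<otimes> foldr (\<otimes>) ws \<one>) \<in> P" for ws a n
    using that
  proof (induction ws arbitrary: a n)
    case Nil
    then have "t [^] n \<otimes> a \<in> P" "t [^] n \<otimes> a \<in> Q" using tQ by auto
    then show ?case using PQ by blast
  next
    case (Cons s ws)
    let ?w = "foldr (\<otimes>) ws \<one>"
    have w: "?w \<in> carrier G" using Cons.prems(1) SG by (intro foldr_mult_closed) auto
    have s: "s \<in> ?S" "s \<in> carrier G" using Cons.prems(1) SG by auto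
    show ?case
    proof (cases "n \<le> D")
      case True
      then show ?thesis by (simp add: trans_le_add1)
    next
      case False
      then have n: "n = (n - D) + D" by simp
      have "t [^] n \<otimes> (a \<otimes> (s \<otimes> ?w)) = t [^] (n - D) \<otimes> (t [^] D \<otimes> (a \<otimes> s) \<otimes> ?w)"
        by (subst n, subst nat_pow_mult[symmetric]) (use t s w Cons.prems(2) in \<open>simp_all add: m_assoc\<close>)
      then have "t [^] (n - D) \<otimes> (t [^] D \<otimes> (a \<otimes> s) \<otimes> ?w) \<in> P" using Cons.prems(4) by simp
      then have "n - D \<le> D * length ws"
        using Cons.prems s t by (intro Cons.IH[of "t [^] D \<otimes> (a \<otimes> s)"] step) auto
      then show ?thesis using False by simp
    qed
  qed
  show ?thesis
  proof (intro exI[of _ D] ballI allI impI)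
    fix a w and n :: nat
    assume a: "a \<in> carrier G" "a \<in> Q" and w: "w \<in> carrier G" and P: "t [^] n \<otimes> a \<otimes> w \<in> P"
    obtain ws where ws: "set ws \<subseteq> ?S" "foldr (\<otimes>) ws \<one> = w" "length ws = word_length G S w"
      using word_length_witness[OF S(2), of w] S(3) w by auto
    have "t [^] n \<otimes> (a \<otimes> foldr (\<otimes>) ws \<one>) \<in> P" using P t a w ws(2) by (simp add: m_assoc)
    from words[OF ws(1) a this] show "n \<le> D * word_length G S w" by (simp add: ws(3))
  qed
qed

text \<open>An ultrafilter containing a singleton is principal. So \<open>\<omega>\<close> contains
  the complement of every singleton, hence every cofinite set, and limits at infinity become limits
  along \<open>\<omega>\<close>.\<close>

lemma nonprincipal_ultrafilter_le_sequentially: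
  assumes "nonprincipal_ultrafilter \<omega>"
  shows "\<omega> \<le> sequentially"
proof -
  have bot: "\<omega> \<noteq> bot" and ultra: "\<And>P. eventually P \<omega> \<or> eventually (\<lambda>i. \<not> P i) \<omega>"
    and nonp: "\<And>i. \<omega> \<noteq> principal {i}"
    using assms unfolding nonprincipal_ultrafilter_def by auto
  have neq: "eventually (\<lambda>n. n \<noteq> i) \<omega>" for i
  proof (rule ccontr)
    assume "\<not> ?thesis"
    then have i: "eventually (\<lambda>n. n = i) \<omega>" using ultra[of "\<lambda>n. n = i"] by simp
    have "eventually P \<omega> \<longleftrightarrow> P i" for P
    proof
      assume "eventually P \<omega>"
      from eventually_happens'[OF bot eventually_conj[OF this i]] show "P i" by auto
    next
      assume "P i"
      with i show "eventually P \<omega>" by (auto elim: eventually_mono)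
    qed
    then have "\<omega> = principal {i}" by (simp add: filter_eq_iff eventually_principal)
    with nonp show False by blast
  qed
  show ?thesis
  proof (rule filter_leI)
    fix P assume "eventually P sequentially"
    then obtain N where N: "\<forall>n\<ge>N. P n" by (auto simp: eventually_sequentially)
    have "eventually (\<lambda>n. \<forall>i\<in>{..<N}. n \<noteq> i) \<omega>"
      using neq by (simp add: eventually_ball_finite)
    then show "eventually P \<omega>" by (rule eventually_mono) (use N in \<open>metis lessThan_iff not_le\<close>)
  qed
qed

lemma incseq_unbounded_at_top:
  fixes d :: "nat \<Rightarrow> real"
  assumes "incseq d" "\<not> bdd_above (range d)"
  shows "filterlim d at_top sequentially"
  unfolding filterlim_at_top
proof
  fix Z
  obtain n where "d n > Z" using assms(2) by (metis bdd_aboveI2 not_le)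
  then show "\<forall>\<^sub>F x in sequentially. Z \<le> d x"
    unfolding eventually_sequentially using incseqD[OF assms(1)] by (meson less_imp_le order_trans)
qed

section \<open>Length of powers, and triviality of the FC-centre on the cone\<close>

lemma (in group) word_length_pow_le:
  assumes S: "S \<subseteq> carrier G" "generate G S = carrier G" and h: "h \<in> carrier G"
  shows "word_length G S (h [^] (n::nat)) \<le> n * word_length G S h"
proof (induction n)
  case (Suc n)
  have "word_length G S (h [^] n \<otimes> h) \<le> word_length G S (h [^] n) + word_length G S h"
    using S h by (intro word_length_mult_le) auto
  with Suc show ?case by simp
qed (simp add: word_length_one)

lemma (in group) FC_center_subset_cone_kernel:
  fixes d :: "nat \<Rightarrow> real"
  assumes S: "S \<subseteq> carrier G" "generate G S = carrier G" and pos: "\<And>n. d n > 0" and inc: "incseq d"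
    and lim: "filterlim d at_top \<omega>"
  shows "FC_center G \<subseteq> action_kernel G (asymptotic_cone G S \<omega> d) (cone_action G)"
proof
  fix g assume g: "g \<in> FC_center G"
  let ?C = "{inv x \<otimes> g \<otimes> x | x. x \<in> carrier G}"
  have fin: "finite ?C" using g by (simp add: FC_center_def)
  define B where "B = Max (word_length G S ` ?C)"
  have B: "word_length G S (inv x \<otimes> g \<otimes> x) \<le> B" if "x \<in> carrier G" for x
    unfolding B_def using fin that by (intro Max_ge) auto
  have "((\<lambda>n. real (word_length G S (inv (x n) \<otimes> g \<otimes> x n)) / d n) \<longlongrightarrow> 0) \<omega>"
    if x: "x \<in> admissible G S d" for x
  proof (rule tendsto_sandwich[OF _ _ tendsto_const])
    show "((\<lambda>n. real B / d n) \<longlongrightarrow> 0) \<omega>" by (rule tendsto_divide_0[OF tendsto_const filterlim_at_top_imp_at_infinity[OF lim]])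
    show "\<forall>\<^sub>F n in \<omega>. 0 \<le> real (word_length G S (inv (x n) \<otimes> g \<otimes> x n)) / d n"
      using pos by (simp add: less_imp_le)
    show "\<forall>\<^sub>F n in \<omega>. real (word_length G S (inv (x n) \<otimes> g \<otimes> x n)) / d n \<le> real B / d n"
      using pos B x by (intro always_eventually allI divide_right_mono) (auto simp: admissible_def less_imp_le)
  qed
  then show "g \<in> action_kernel G (asymptotic_cone G S \<omega> d) (cone_action G)"
    using g unfolding cone_kernel_eq[OF S pos inc] FC_center_def by blast
qed

section \<open>Elements moving a limit point act non-trivially on the cone\<close>

context nonelementary_convergence_action
begin

text \<open>If the repelling point is \<open>p\<close> itself, multiplying by \<open>inv g\<close>
  on the right moves it to \<open>\<phi> g p\<close>.\<close>

lemma attracting_repelling_pair: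
  assumes g: "g \<in> carrier G" and p: "p \<in> limits" "\<phi> g p \<noteq> p"
  obtains f x where "collapses f x p" "x \<noteq> p"
proof -
  obtain f x where f: "collapses f x p" by (rule limit_point_collapses[OF p(1)])
  show thesis
  proof (cases "x = p")
    case False
    with f show thesis by (rule that)
  next
    case True
    have pX: "p \<in> topspace X" using p limits_subset by blast
    have "collapses (\<lambda>n. f n \<otimes> inv g) (\<phi> (inv (inv g)) x) p"
      by (rule collapses_mult_right[OF f inv_closed[OF g]])
    moreover have "\<phi> (inv (inv g)) x \<noteq> p" using True g p(2) by simp
    ultimately show thesis by (rule that)
  qed
qed

text \<open>The coarse bound is applied to \<open>inv h\<close>, where \<open>h\<close> sends the
  complement of \<open>B\<close> into a set \<open>A'\<close> that \<open>g\<close> moves off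
  itself. \<open>P\<close> and \<open>Q\<close> record whether most of a fixed triple lands in
  \<open>A'\<close> or in \<open>B\<close>.\<close>

lemma conjugate_length_grows:
  assumes S: "finite S" "S \<subseteq> carrier G" "generate G S = carrier G"
    and g: "g \<in> carrier G" and p: "p \<in> limits" "\<phi> g p \<noteq> p"
  shows "\<exists>h\<in>carrier G. \<exists>D. \<forall>m::nat. m \<le> D * word_length G S (inv (h [^] m) \<otimes> inv g \<otimes> h [^] m) + 1"
proof -
  have pX: "p \<in> topspace X" using p limits_subset by blast
  obtain f x where f: "collapses f x p" "x \<noteq> p" by (rule attracting_repelling_pair[OF g p])
  have xX: "x \<in> topspace X" by (rule collapsesD(3)[OF f(1)])
  obtain r where r: "r \<in> topspace X" "p \<noteq> r" "x \<noteq> r"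
    using three_limit_points_avoiding[of x] limits_subset by (metis subsetD)
  obtain U V W A B C where Q: "openin X U" "openin X V" "openin X W"
    "closedin X A" "closedin X B" "closedin X C" "p \<in> U" "U \<subseteq> A" "x \<in> V" "V \<subseteq> B" "r \<in> W" "W \<subseteq> C"
    "A \<inter> B = {}" "A \<inter> C = {}" "B \<inter> C = {}"
    by (rule three_closed_neighbourhoods[OF pX xX r(1) not_sym[OF f(2)] r(2,3)])
  obtain Y where Y: "openin X Y" "p \<in> Y" "\<phi> g ` Y \<inter> Y = {}"
    by (rule displaced_neighbourhood[OF g pX p(2)])
  obtain U' A' where U': "openin X U'" "closedin X A'" "p \<in> U'" "U' \<subseteq> A'" "A' \<subseteq> U \<inter> Y"
    by (rule closed_neighbourhood[of "U \<inter> Y" p]) (use Q Y in auto)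
  note sub = closedin_subset[OF U'(2)] closedin_subset[OF Q(5)]
  obtain i where i: "\<phi> (f i) ` (topspace X - V) \<subseteq> U'" by (rule collapses_set[OF f(1) U'(1,3) Q(2,9)])
  define h where "h = f i"
  have h: "h \<in> carrier G" unfolding h_def by (rule collapsesD(2)[OF f(1)])
  have hA: "\<phi> h u \<in> A'" if "u \<in> topspace X" "u \<notin> B" for u
    using i that U'(4) Q(10) unfolding h_def by blast
  have disj: "A' \<inter> B = {}" "\<phi> g ` A' \<inter> A' = {}" using U'(5) Q(8,13) Y(3) by blast+
  have rAB: "r \<notin> A'" "r \<notin> B" and pA: "p \<in> A'" "p \<notin> B"
    using U'(3-5) Q(7-15) by blast+
  have hB: "\<phi> (inv h) u \<in> B" if "u \<in> topspace X" "u \<notin> A'" for u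
  proof (rule ccontr)
    assume "\<phi> (inv h) u \<notin> B"
    then have "\<phi> h (\<phi> (inv h) u) \<in> A'" using that(1) h by (intro hA) auto
    with that h show False by simp
  qed

  \<comment> \<open>The triple is \<open>a\<close>, \<open>b\<close>, \<open>r\<close>. Two members
    lie in \<open>A'\<close>, which puts the identity in \<open>P\<close>; the third lies outside
    \<open>A'\<close> and \<open>B\<close>, which gives \<open>inv h\<close> infinite order.\<close>
  define a b where "a = \<phi> h r" and "b = \<phi> h p"
  have X: "a \<in> topspace X" "b \<in> topspace X" using h r pX by (auto simp: a_def b_def)
  have aA: "a \<in> A'" "b \<in> A'" using hA rAB pA r(1) pX by (auto simp: a_def b_def)
  have neq: "a \<noteq> b" "a \<noteq> r" "b \<noteq> r" using r(1,2) pX h aA rAB by (auto simp: a_def b_def)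
  define two where "two = (\<lambda>E g. \<phi> g a \<in> E \<and> \<phi> g b \<in> E \<or> \<phi> g a \<in> E \<and> \<phi> g r \<in> E \<or> \<phi> g b \<in> E \<and> \<phi> g r \<in> E)"
  define P where "P = {k. two A' k}"
  define Q where "Q = {k. two B k}"
  have PQ: "P \<inter> Q = {}" unfolding P_def Q_def two_def using disj(1) by blast
  \<comment> \<open>At least two members of the triple are carried outside \<open>A'\<close> by
    \<open>k\<close>, and \<open>inv h\<close> sends their images into \<open>B\<close>. This is the
    covering hypothesis of the coarse bound.\<close>
  have outside: "inv h \<otimes> k \<in> Q" if k: "k \<in> carrier G" and "\<not> two A' k" for k
  proof -
    have "\<phi> (inv h \<otimes> k) v \<in> B" if "v \<in> topspace X" "\<phi> k v \<notin> A'" for v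
      using hB[of "\<phi> k v"] that h k by (simp add: act_mult)
    then show ?thesis using \<open>\<not> two A' k\<close> X r(1) unfolding Q_def two_def by blast
  qed
  \<comment> \<open>At most one of the distinct points \<open>\<phi> s a\<close>,
    \<open>\<phi> s b\<close>, \<open>\<phi> s r\<close> is repelling, and were \<open>y\<close>
    outside \<open>E\<close>, the images of the others would eventually leave
    \<open>E\<close>.\<close>
  have two_limit: "y \<in> E" if c: "collapses l u y" and E: "closedin X E" and s: "s \<in> carrier G"
    and l: "\<And>n. two E (l n \<otimes> s)" for l u y E s
  proof (rule ccontr)
    assume "y \<notin> E"
    then have yE: "openin X (topspace X - E)" "y \<in> topspace X - E" using E collapsesD(4)[OF c] by auto
    have ev: "\<forall>\<^sub>F n in sequentially. \<phi> s v = u \<or> \<phi> (l n) (\<phi> s v) \<in> topspace X - E" if "v \<in> topspace X" for v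
      using collapses_point_eventually[OF c act_closed[OF s that] _ yE] by (cases "\<phi> s v = u") auto
    from eventually_happens[OF eventually_conj[OF ev[OF X(1)] eventually_conj[OF ev[OF X(2)] ev[OF r(1)]]]]
    obtain n where n: "\<phi> s a = u \<or> \<phi> (l n) (\<phi> s a) \<notin> E" "\<phi> s b = u \<or> \<phi> (l n) (\<phi> s b) \<notin> E"
      "\<phi> s r = u \<or> \<phi> (l n) (\<phi> s r) \<notin> E" by auto
    have lG: "l n \<in> carrier G" by (rule collapsesD(2)[OF c])
    have "\<phi> s a \<noteq> \<phi> s b" "\<phi> s a \<noteq> \<phi> s r" "\<phi> s b \<noteq> \<phi> s r" using neq s X r(1) by auto
    with n l[of n] show False unfolding two_def act_mult[OF lG s X(1)] act_mult[OF lG s X(2)] act_mult[OF lG s r(1)]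
      by metis
  qed
  have fin: "finite {k \<in> carrier G. k \<in> Q \<and> k \<otimes> s \<in> P}" if s: "s \<in> carrier G" for s
  proof (rule ccontr)
    assume "infinite {k \<in> carrier G. k \<in> Q \<and> k \<otimes> s \<in> P}"
    then obtain l u y where l: "collapses l u y" "range l \<subseteq> {k \<in> carrier G. k \<in> Q \<and> k \<otimes> s \<in> P}"
      by (rule infinite_collapses) auto
    then have ln: "l n \<in> carrier G" "l n \<in> Q" "l n \<otimes> s \<in> P" for n by auto
    have "y \<in> B" by (rule two_limit[OF l(1) \<open>closedin X B\<close> one_closed]) (use ln in \<open>simp add: Q_def\<close>)
    moreover have "y \<in> A'" by (rule two_limit[OF l(1) U'(2) s]) (use ln in \<open>simp add: P_def\<close>)
    ultimately show False using disj(1) by blast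
  qed
  let ?t = "inv h"
  have t: "?t \<in> carrier G" using h by simp
  have tpow: "?t [^] e \<noteq> \<one>" if "e > 0" for e :: nat
  proof -
    obtain c where c: "e = Suc c" using \<open>e > 0\<close> gr0_implies_Suc by blast
    have "\<phi> (?t [^] Suc c) r \<in> B"
    proof (rule act_pow_attracted[OF t _ _ r(1)])
      show "B \<inter> A' = {}" using disj(1) by blast
    qed (use hB rAB in auto)
    then show ?thesis using c rAB(2) r(1) by auto
  qed
  obtain D where D: "\<And>a w n. a \<in> carrier G \<Longrightarrow> w \<in> carrier G \<Longrightarrow> a \<in> Q \<Longrightarrow> ?t [^] n \<otimes> a \<otimes> w \<in> P \<Longrightarrow>
      n \<le> D * word_length G S w"
    using word_length_coarse_lower_bound[OF S PQ t tpow _ fin] outside unfolding P_def by blast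
  have "m \<le> D * word_length G S (inv (h [^] m) \<otimes> inv g \<otimes> h [^] m) + 1" for m :: nat
  proof (cases m)
    case (Suc n)
    let ?w = "inv (h [^] m) \<otimes> inv g \<otimes> h [^] m"
    \<comment> \<open>\<open>h [^] m\<close> keeps \<open>a\<close> and \<open>b\<close> in
      \<open>A'\<close>, \<open>g\<close> moves them out, and one factor \<open>inv h\<close> then
      leads into \<open>Q\<close>. That factor accounts for \<open>n\<close> in place of
      \<open>m\<close> and for the \<open>+ 1\<close>. The product
      \<open>?t [^] n \<otimes> ?a \<otimes> ?w\<close> is the identity.\<close>
    let ?a = "inv h \<otimes> (g \<otimes> h [^] m)"
    have hm: "h [^] m \<in> carrier G" using h by simp
    have aQ: "?a \<in> Q"
    proof (rule outside)
      have "\<phi> (h [^] m) v \<in> A'" if "v \<in> A'" for v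
        unfolding Suc by (rule act_pow_attracted[OF h hA disj(1)]) (use that sub disj(1) in auto)
      then have "\<phi> (g \<otimes> h [^] m) v \<notin> A'" if "v \<in> A'" for v
        using that disj(2) sub(1) g hm by (auto simp: act_mult subset_iff)
      then show "\<not> two A' (g \<otimes> h [^] m)" using aA unfolding two_def by blast
    qed (use g hm in simp)
    have "?t [^] n \<otimes> ?a \<otimes> ?w = ?t [^] n \<otimes> ?t \<otimes> (g \<otimes> (h [^] m \<otimes> inv (h [^] m)) \<otimes> inv g) \<otimes> h [^] m"
      using h g hm by (simp only: m_assoc inv_closed m_closed nat_pow_closed)
    also have "\<dots> = ?t [^] m \<otimes> h [^] m" using g hm h unfolding Suc by (simp add: r_inv)
    also have "\<dots> = \<one>" using h by (simp add: nat_pow_inv)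
    finally have "?t [^] n \<otimes> ?a \<otimes> ?w \<in> P" using aA X unfolding P_def two_def by simp
    then have "n \<le> D * word_length G S ?w" using aQ g h hm by (intro D) auto
    then show ?thesis using Suc by simp
  qed simp
  with h show ?thesis by blast
qed

lemma cone_kernel_subset_limit_kernel:
  fixes d :: "nat \<Rightarrow> real"
  assumes S: "finite S" "S \<subseteq> carrier G" "generate G S = carrier G"
    and pos: "\<And>n. d n > 0" and inc: "incseq d" and lim: "filterlim d at_top \<omega>" and bot: "\<omega> \<noteq> bot"
  shows "action_kernel G (asymptotic_cone G S \<omega> d) (cone_action G) \<subseteq> action_kernel G limits \<phi>"
proof (rule subsetI, rule ccontr)
  fix g assume g: "g \<in> action_kernel G (asymptotic_cone G S \<omega> d) (cone_action G)"
    and notin: "g \<notin> action_kernel G limits \<phi>"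
  have gG: "g \<in> carrier G" using g by (simp add: action_kernel_def)
  then obtain p where p: "p \<in> limits" "\<phi> g p \<noteq> p" using notin by (auto simp: action_kernel_def)
  have pX: "p \<in> topspace X" using p limits_subset by blast
  \<comment> \<open>The growth bound concerns conjugates of an inverse, so it is applied to
    \<open>inv g\<close>, which moves \<open>p\<close> as well.\<close>
  have ip: "\<phi> (inv g) p \<noteq> p" using p(2) act_act_inv[OF gG pX] by auto
  obtain h D where h: "h \<in> carrier G"
    and D: "\<And>m::nat. m \<le> D * word_length G S (inv (h [^] m) \<otimes> g \<otimes> h [^] m) + 1"
    using conjugate_length_grows[OF S inv_closed[OF gG] p(1) ip] gG by auto
  \<comment> \<open>Rounding down bounds the length of \<open>x n\<close> by \<open>d n\<close>
    times that of \<open>h\<close>, so \<open>x\<close> is admissible, while conjugation by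
    \<open>x n\<close> gives length linear in \<open>d n\<close>.\<close>
  define x where "x n = h [^] nat \<lfloor>d n\<rfloor>" for n
  let ?l = "\<lambda>n. real (word_length G S (inv (x n) \<otimes> g \<otimes> x n))"
  have floor_le: "real (nat \<lfloor>d n\<rfloor>) \<le> d n" for n using pos[of n] by simp
  have "real (word_length G S (x n)) / d n \<le> real (word_length G S h)" for n
  proof -
    have "real (word_length G S (x n)) \<le> real (nat \<lfloor>d n\<rfloor>) * real (word_length G S h)"
      unfolding x_def using word_length_pow_le[OF S(2,3) h] by (metis of_nat_le_iff of_nat_mult)
    also have "\<dots> \<le> d n * real (word_length G S h)" using floor_le by (rule mult_right_mono) simp
    finally show ?thesis using pos[of n] by (simp add: divide_le_eq mult.commute)
  qed
  then have "x \<in> admissible G S d" unfolding admissible_def using h by (auto simp: x_def)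
  then have "((\<lambda>n. ?l n / d n) \<longlongrightarrow> 0) \<omega>"
    using g unfolding cone_kernel_eq[OF S(2,3) pos inc] by blast
  moreover have "((\<lambda>n. 2 / d n) \<longlongrightarrow> 0) \<omega>"
    by (rule tendsto_divide_0[OF tendsto_const filterlim_at_top_imp_at_infinity[OF lim]])
  ultimately have "((\<lambda>n. real D * (?l n / d n) + 2 / d n) \<longlongrightarrow> real D * 0 + 0) \<omega>"
    by (intro tendsto_intros)
  then have "1 \<le> real D * 0 + 0"
  proof (rule tendsto_lowerbound[OF _ always_eventually bot], intro allI)
    fix n
    \<comment> \<open>One unit is lost to the floor and one to the additive constant of the growth
      bound, hence the 2.\<close>
    have "d n - 1 \<le> real (nat \<lfloor>d n\<rfloor>)" by linarith
    also have "\<dots> \<le> real D * ?l n + 1"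
      unfolding x_def using D[of "nat \<lfloor>d n\<rfloor>"] by (metis of_nat_1 of_nat_add of_nat_le_iff of_nat_mult)
    finally have "d n \<le> real D * ?l n + 2" by simp
    then have "1 \<le> (real D * ?l n + 2) / d n" using pos[of n] by simp
    then show "1 \<le> real D * (?l n / d n) + 2 / d n" by (simp add: add_divide_distrib)
  qed
  then show False by simp
qed

end

theorem corollary1p4:
  fixes G :: "('a, 'm) monoid_scheme" (structure)
    and S :: "'a set"
    and X :: "'p topology"
    and \<phi> :: "'a \<Rightarrow> 'p \<Rightarrow> 'p"
    and \<omega> :: "nat filter"
    and d :: "nat \<Rightarrow> real"
  assumes "group G"
    and "finite S" and "S \<subseteq> carrier G" and "generate G S = carrier G"
    and "compact_space X" and "metrizable_space X"
    and "convergence_action G X \<phi>"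
    and "infinite (limit_set G X \<phi>) \<or> card (limit_set G X \<phi>) > 2"
    and "nonprincipal_ultrafilter \<omega>"
    and "\<forall>n. d n > 0" and "incseq d" and "\<not> bdd_above (range d)"
  shows "action_kernel G (asymptotic_cone G S \<omega> d) (cone_action G) =
           action_kernel G (limit_set G X \<phi>) \<phi> \<and>
         action_kernel G (limit_set G X \<phi>) \<phi> = finite_radical G \<and>
         finite_radical G = FC_center G \<and>
         FC_center G = amenable_radical G \<and>
         is_finite_radical G (finite_radical G) \<and>
         is_amenable_radical G (amenable_radical G)"
proof -
  interpret convergence_action G X \<phi> by fact
  interpret compact_convergence_action G X \<phi> by unfold_locales fact+
  interpret nonelementary_convergence_action G X \<phi> by unfold_locales fact
  define K where "K = action_kernel G limits \<phi>"
  let ?C = "action_kernel G (asymptotic_cone G S \<omega> d) (cone_action G)"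
  have pos: "d n > 0" for n using assms(10) by blast
  have lim: "filterlim d at_top \<omega>"
    using incseq_unbounded_at_top[OF assms(11,12)] nonprincipal_ultrafilter_le_sequentially[OF assms(9)]
    by (rule filterlim_mono[OF _ order_refl])
  have bot: "\<omega> \<noteq> bot" using assms(9) by (simp add: nonprincipal_ultrafilter_def)
  have K: "K \<lhd> G" "finite K"
    unfolding K_def by (rule limit_kernel_normal, rule finite_limit_kernel)
  have C_K: "?C \<subseteq> K"
    unfolding K_def by (rule cone_kernel_subset_limit_kernel[OF assms(2-4) pos assms(11) lim bot])
  have FC_C: "FC_center G \<subseteq> ?C"
    by (rule FC_center_subset_cone_kernel[OF assms(3,4) pos assms(11) lim])
  have K_FC: "K \<subseteq> FC_center G" by (rule normal_finite_subset_FC_center[OF K])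
  have fin: "is_finite_radical G K"
    unfolding is_finite_radical_def
  proof (intro conjI allI impI K)
    \<comment> \<open>Maximality is obtained through the cone: \<open>N\<close> lies in the
      FC-centre, hence in the kernel on the cone, hence in \<open>K\<close>.\<close>
    fix N assume "N \<lhd> G \<and> finite N"
    then have "N \<subseteq> FC_center G" by (intro normal_finite_subset_FC_center) auto
    with FC_C C_K show "N \<subseteq> K" by (meson order_trans)
  qed
  \<comment> \<open>Two subgroups with the maximality property contain each other, so
    \<open>THE\<close> returns \<open>K\<close>; the same holds for the amenable radical.\<close>
  have "finite_radical G = K"
    unfolding finite_radical_def
  proof (rule the_equality[of "is_finite_radical G", OF fin])
    show "N = K" if "is_finite_radical G N" for N
      using that fin unfolding is_finite_radical_def by blast
  qed
  moreover have am: "is_amenable_radical G K"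
    unfolding is_amenable_radical_def
  proof (intro conjI allI impI K)
    show "amenable (G\<lparr>carrier := K\<rparr>)"
      by (rule amenable_finite_subgroup[OF normal_imp_subgroup[OF K(1)] K(2)])
    fix N assume "N \<lhd> G \<and> amenable (G\<lparr>carrier := N\<rparr>)"
    then show "N \<subseteq> K" unfolding K_def by (intro amenable_normal_subset_limit_kernel) auto
  qed
  have "amenable_radical G = K"
    unfolding amenable_radical_def
  proof (rule the_equality[of "is_amenable_radical G", OF am])
    show "N = K" if "is_amenable_radical G N" for N
      using that am unfolding is_amenable_radical_def by blast
  qed
  moreover have "FC_center G = K" "?C = K" using C_K FC_C K_FC by (auto intro: subset_antisym)
  ultimately show ?thesis
    using fin am unfolding K_def[symmetric] by simp
qed

end
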